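(* There is a randomized distributed algorithm in the CONGEST model for the unweighted minimum 3-edge-connected spanning subgraph problem (find a 3-edge-connected spanning subgraph with the minimum number of edges of a given 3-edge-connected graph) with an expected approximation ratio of $O(\log n)$ and time complexity $O(D\log^3 n)$ rounds, where $n$ is the number of vertices and $D$ is the diameter of the input graph.
   Context: An undirected graph is $k$-edge-connected if it remains connected after the removal of any $k-1$ edges. In the CONGEST model, the input graph is the communication network; vertices communicate in synchronous rounds with messages of $O(\log n)$ bits per edge per round. Initially each vertex knows its neighbours' ids; at the end each vertex knows which incident edges are in the solution. *)

theory Defs
  imports "HOL-Probability.Probability"
begin

section \<open>Finite simple undirected graphs\<close>

definition simple_graph :: "'a set \<Rightarrow> 'a set set \<Rightarrow> bool" where
  "simple_graph V E \<longleftrightarrow> finite V \<and> V \<noteq> {} \<and> (\<forall>e\<in>E. e \<subseteq> V \<and> card e = 2)"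

definition adj_rel :: "'a set set \<Rightarrow> ('a \<times> 'a) set" where
  "adj_rel E = {(u, v). {u, v} \<in> E}"

definition neighbours :: "'a set set \<Rightarrow> 'a \<Rightarrow> 'a set" where
  "neighbours E v = {u. {u, v} \<in> E}"

definition graph_connected :: "'a set \<Rightarrow> 'a set set \<Rightarrow> bool" where
  "graph_connected V E \<longleftrightarrow> (\<forall>u\<in>V. \<forall>v\<in>V. (u, v) \<in> (adj_rel E)\<^sup>*)"

text \<open>Every set of at most \<open>k - 1\<close> edges is considered, not only those of size exactly
  \<open>k - 1\<close>; otherwise a graph with fewer than \<open>k - 1\<close> edges would qualify vacuously.\<close>

definition edge_connected :: "nat \<Rightarrow> 'a set \<Rightarrow> 'a set set \<Rightarrow> bool" where
  "edge_connected k V E \<longleftrightarrow> (\<forall>F\<subseteq>E. card F < k \<longrightarrow> graph_connected V (E - F))"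

text \<open>Only meaningful on connected graphs.\<close>

definition graph_dist :: "'a set set \<Rightarrow> 'a \<Rightarrow> 'a \<Rightarrow> nat" where
  "graph_dist E u v = (LEAST d. (u, v) \<in> adj_rel E ^^ d)"

definition graph_diameter :: "'a set \<Rightarrow> 'a set set \<Rightarrow> nat" where
  "graph_diameter V E = Max {graph_dist E u v | u v. u \<in> V \<and> v \<in> V}"

text \<open>A spanning subgraph of \<open>(V, E)\<close> is given by its edge set \<open>H \<subseteq> E\<close>.\<close>

definition ecss :: "nat \<Rightarrow> 'a set \<Rightarrow> 'a set set \<Rightarrow> 'a set set \<Rightarrow> bool" where
  "ecss k V E H \<longleftrightarrow> H \<subseteq> E \<and> edge_connected k V H"

definition min_ecss_size :: "nat \<Rightarrow> 'a set \<Rightarrow> 'a set set \<Rightarrow> nat" where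
  "min_ecss_size k V E = Min (card ` {H. ecss k V E H})"


section \<open>Randomized algorithms in the CONGEST model\<close>

text \<open>
  Vertices are identified with their (unique, natural number) ids. All vertices run the same
  program, whose local states have type \<open>'s\<close>; local computation is unrestricted and uses
  private randomness.
  \<^item> \<open>start v N\<close>: distribution of the initial state of the vertex with id \<open>v\<close> whose neighbours'
    ids form the set \<open>N\<close>. Nothing else is known initially; in particular neither the number of
    vertices nor the diameter.
  \<^item> \<open>send s u\<close>: the bit string sent to neighbour \<open>u\<close> in state \<open>s\<close>; the empty string
    means that no message is sent.
  \<^item> \<open>receive s m\<close>: distribution of the new state, where \<open>m u\<close> is the message from \<open>u\<close>.
  \<^item> \<open>result s\<close>: \<open>None\<close> while running; \<open>Some S\<close> if the vertex has terminated
    and its incident solution edges are those leading to the vertices in \<open>S\<close>.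
\<close>

record 's congest_alg =
  start :: "nat \<Rightarrow> nat set \<Rightarrow> 's pmf"
  send :: "'s \<Rightarrow> nat \<Rightarrow> bool list"
  receive :: "'s \<Rightarrow> (nat \<Rightarrow> bool list) \<Rightarrow> 's pmf"
  result :: "'s \<Rightarrow> nat set option"

text \<open>Message from \<open>u\<close> to \<open>v\<close>: only along edges, and only from vertices still running.\<close>

definition message :: "'s congest_alg \<Rightarrow> nat set set \<Rightarrow> (nat \<Rightarrow> 's) \<Rightarrow> nat \<Rightarrow> nat \<Rightarrow> bool list" where
  "message A E \<sigma> u v =
     (if {u, v} \<in> E \<and> result A (\<sigma> u) = None then send A (\<sigma> u) v else [])"

text \<open>One synchronous round. The product distribution makes the vertices' coins independent.
  States outside \<open>V\<close> are irrelevant.\<close>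

definition congest_round ::
  "'s congest_alg \<Rightarrow> nat set \<Rightarrow> nat set set \<Rightarrow> (nat \<Rightarrow> 's) \<Rightarrow> (nat \<Rightarrow> 's) pmf" where
  "congest_round A V E \<sigma> = Pi_pmf V undefined (\<lambda>v.
     if result A (\<sigma> v) = None then receive A (\<sigma> v) (\<lambda>u. message A E \<sigma> u v)
     else return_pmf (\<sigma> v))"

primrec congest_run ::
  "'s congest_alg \<Rightarrow> nat set \<Rightarrow> nat set set \<Rightarrow> nat \<Rightarrow> (nat \<Rightarrow> 's) pmf" where
  "congest_run A V E 0 = Pi_pmf V undefined (\<lambda>v. start A v (neighbours E v))"
| "congest_run A V E (Suc t) = bind_pmf (congest_run A V E t) (congest_round A V E)"

definition message_bits_le :: "'s congest_alg \<Rightarrow> nat set \<Rightarrow> nat set set \<Rightarrow> real \<Rightarrow> bool" where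
  "message_bits_le A V E b \<longleftrightarrow>
     (\<forall>t. \<forall>\<sigma>\<in>set_pmf (congest_run A V E t). \<forall>u\<in>V. \<forall>v\<in>V.
        real (length (message A E \<sigma> u v)) \<le> b)"

definition chosen_edges :: "'s congest_alg \<Rightarrow> nat set set \<Rightarrow> (nat \<Rightarrow> 's) \<Rightarrow> nat set set" where
  "chosen_edges A E \<sigma> =
     {{u, v} | u v. {u, v} \<in> E \<and> (\<exists>S. result A (\<sigma> u) = Some S \<and> v \<in> S)}"

text \<open>All vertices have terminated, and each of them knows exactly which of its incident edges
  are chosen (so the two endpoints of an edge agree).\<close>

definition all_done :: "'s congest_alg \<Rightarrow> nat set \<Rightarrow> nat set set \<Rightarrow> (nat \<Rightarrow> 's) \<Rightarrow> bool" where
  "all_done A V E \<sigma> \<longleftrightarrow>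
     (\<forall>v\<in>V. result A (\<sigma> v) = Some (neighbours (chosen_edges A E \<sigma>) v))"

end

theory Submission
  imports Defs
begin

text \<open>
  Every vertex of a 3-edge-connected subgraph on \<open>n > 1\<close> vertices has positive degree, so an optimal
  solution has at least \<open>n / 2\<close> edges, and it suffices to find a 3-edge-connected spanning subgraph
  with \<open>O(n)\<close> edges in expectation. If \<open>H\<^sub>1\<close>, \<open>H\<^sub>2\<close>, \<open>H\<^sub>3\<close> are such that the endpoints of each edge of
  \<open>E - (H\<^sub>1 \<union> \<dots> \<union> H\<^sub>i\<^sub>-\<^sub>1)\<close> are connected in \<open>H\<^sub>i\<close>, then \<open>H\<^sub>1 \<union> H\<^sub>2 \<union> H\<^sub>3\<close> is 3-edge-connected. Such an
  \<open>H\<^sub>i\<close> comes from the random shift clustering of Miller, Peng and Xu: every vertex \<open>u\<close> draws a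
  geometric shift \<open>r u\<close> and every vertex \<open>v\<close> joins the vertex \<open>u\<close> maximizing \<open>r u - dist u v\<close>; then
  each vertex keeps one edge to every adjacent cluster, its own included. By memorylessness, the
  expected number of vertices within 2 of the maximum is constant. Truncating the shifts at \<open>L\<close>
  bounds the number of rounds, and costs only \<open>O(n / 2\<^sup>L)\<close> further clusters per vertex.

  A suitable \<open>L\<close> with \<open>n \<le> 2\<^sup>L\<close> and \<open>L = O(D log n)\<close> is found by flooding the largest id and the
  largest degree \<open>\<Delta>\<close>: if the largest id stops changing after round \<open>d\<close>, then it has reached everybody
  within distance \<open>d \<le> D\<close>, whence \<open>n \<le> (\<Delta> + 1)\<^sup>d\<close>. To detect this without knowing \<open>D\<close>, the time of
  the last known change is flooded as well; all vertices stop simultaneously in round \<open>3 d + 2\<close>.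
\<close>

section \<open>Binary messages\<close>

text \<open>Least significant bit first and without leading zeros, so that 0 becomes the empty
  string: staying silent is the same as sending 0.\<close>

fun bits :: "nat \<Rightarrow> bool list" where
  "bits n = (if n = 0 then [] else odd n # bits (n div 2))"

declare bits.simps [simp del]

fun unbits :: "bool list \<Rightarrow> nat" where
  "unbits [] = 0"
| "unbits (b # bs) = of_bool b + 2 * unbits bs"

lemma unbits_bits [simp]: "unbits (bits n) = n"
proof (induction n rule: bits.induct)
  case (1 n)
  then show ?case
    by (subst bits.simps) (auto simp: mod_2_eq_odd[symmetric])
qed

lemma bits_0 [simp]: "bits 0 = []"
  by (simp add: bits.simps)

lemma less_power_length_bits: "n < 2 ^ length (bits n)"
proof (induction n rule: bits.induct)
  case (1 n)
  then show ?case
    by (cases "n = 0") (auto simp: bits.simps[of n])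
qed

lemma power_length_bits_le: "n > 0 \<Longrightarrow> 2 ^ length (bits n) \<le> 2 * n"
proof (induction n rule: bits.induct)
  case (1 n)
  show ?case
  proof (cases "n = 1")
    case True
    then show ?thesis by (simp add: bits.simps)
  next
    case False
    then have "2 ^ length (bits (n div 2)) \<le> 2 * (n div 2)"
      using 1 by (intro 1) auto
    then show ?thesis
      using 1(2) by (subst bits.simps) auto
  qed
qed

lemma length_bits_le_log: "n > 0 \<Longrightarrow> real (length (bits n)) \<le> 1 + log 2 (real n)"
proof -
  assume n: "n > 0"
  have "real (2 ^ length (bits n)) \<le> real (2 * n)"
    using power_length_bits_le[OF n] by (rule of_nat_mono)
  then have "2 powr real (length (bits n)) \<le> 2 * real n"
    by (simp add: powr_realpow)
  then have "real (length (bits n)) \<le> log 2 (2 * real n)"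
    using n by (simp add: le_log_iff)
  then show ?thesis
    using n by (simp add: log_mult)
qed

text \<open>Numbers polynomial in \<open>n\<close> fit into logarithmically many bits; the
  additional 1 in the factor absorbs rounding, as \<open>log 2 n \<ge> 1\<close>.\<close>

lemma length_bits_le_if_le_power:
  assumes "m \<le> n ^ k" and "2 \<le> n"
  shows "real (length (bits m)) \<le> (1 + real k) * log 2 (real n)"
proof (cases "m = 0")
  case False
  have "log 2 (real m) \<le> log 2 (real (n ^ k))"
    using False assms by (intro log_mono) (auto simp del: of_nat_power)
  also have "\<dots> = real k * log 2 (real n)"
    using assms by (simp add: log_nat_power)
  finally have "log 2 (real m) \<le> real k * log 2 (real n)" .
  moreover have "1 \<le> log 2 (real n)"
    using assms by simp
  ultimately show ?thesis
    using length_bits_le_log[of m] False by (simp add: algebra_simps)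
next
  case True
  then show ?thesis using assms by simp
qed

section \<open>Algorithms with deterministic rounds\<close>

text \<open>All randomness is drawn in the initial states, so that a run is determined by the coins of
  the vertices.\<close>

definition machine_alg ::
  "'c pmf \<Rightarrow> (nat \<Rightarrow> nat set \<Rightarrow> 'c \<Rightarrow> 's :: countable) \<Rightarrow> ('s \<Rightarrow> nat \<Rightarrow> nat) \<Rightarrow>
    ('s \<Rightarrow> (nat \<Rightarrow> nat) \<Rightarrow> 's) \<Rightarrow> ('s \<Rightarrow> nat set option) \<Rightarrow> nat congest_alg" where
  "machine_alg coin init msg step out =
     \<lparr>start = (\<lambda>v N. map_pmf (\<lambda>c. to_nat (init v N c)) coin),
      send = (\<lambda>s u. bits (msg (from_nat s) u)),
      receive = (\<lambda>s m. return_pmf (to_nat (step (from_nat s) (\<lambda>u. unbits (m u))))),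
      result = (\<lambda>s. out (from_nat s))\<rparr>"

definition machine_msg ::
  "('s \<Rightarrow> nat \<Rightarrow> nat) \<Rightarrow> ('s \<Rightarrow> nat set option) \<Rightarrow> nat set set \<Rightarrow> (nat \<Rightarrow> 's) \<Rightarrow> nat \<Rightarrow> nat \<Rightarrow> nat" where
  "machine_msg msg out E \<sigma> u v = (if {u, v} \<in> E \<and> out (\<sigma> u) = None then msg (\<sigma> u) v else 0)"

primrec machine_run ::
  "(nat \<Rightarrow> nat set \<Rightarrow> 'c \<Rightarrow> 's) \<Rightarrow> ('s \<Rightarrow> nat \<Rightarrow> nat) \<Rightarrow> ('s \<Rightarrow> (nat \<Rightarrow> nat) \<Rightarrow> 's) \<Rightarrow>
    ('s \<Rightarrow> nat set option) \<Rightarrow> nat set set \<Rightarrow> (nat \<Rightarrow> 'c) \<Rightarrow> nat \<Rightarrow> nat \<Rightarrow> 's" where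
  "machine_run init msg step out E \<omega> 0 = (\<lambda>v. init v (neighbours E v) (\<omega> v))"
| "machine_run init msg step out E \<omega> (Suc t) =
     (let \<sigma> = machine_run init msg step out E \<omega> t
      in (\<lambda>v. if out (\<sigma> v) = None then step (\<sigma> v) (\<lambda>u. machine_msg msg out E \<sigma> u v) else \<sigma> v))"

text \<open>The value \<open>undefined\<close> outside \<open>V\<close> is the default of the
  product distributions in \<open>congest_run\<close>, so that both sides agree as
  functions.\<close>

definition encode_states :: "nat set \<Rightarrow> (nat \<Rightarrow> 's :: countable) \<Rightarrow> nat \<Rightarrow> nat" where
  "encode_states V \<sigma> v = (if v \<in> V then to_nat (\<sigma> v) else undefined)"

lemma simple_graph_edgeD:
  assumes "simple_graph V E" "{u, v} \<in> E"
  shows "u \<in> V" "v \<in> V" "u \<noteq> v"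
  using assms unfolding simple_graph_def by (auto simp: card_insert_if dest!: bspec split: if_splits)

lemma message_machine_alg:
  assumes "simple_graph V E"
  shows "message (machine_alg coin init msg step out) E (encode_states V \<sigma>) u v
    = bits (machine_msg msg out E \<sigma> u v)"
  using simple_graph_edgeD[OF assms, of u v]
  by (auto simp: message_def machine_msg_def machine_alg_def encode_states_def)

text \<open>Rounds add no randomness, so the run is the image of the product distribution of the
  coins. The default \<open>d\<close> is arbitrary because coins outside \<open>V\<close> influence
  no state inside \<open>V\<close>.\<close>

lemma congest_run_machine_alg:
  assumes "simple_graph V E"
  shows "congest_run (machine_alg coin init msg step out) V E t
    = map_pmf (\<lambda>\<omega>. encode_states V (machine_run init msg step out E \<omega> t))
        (Pi_pmf V d (\<lambda>_. coin))"
proof (induction t)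
  case 0
  have "finite V" using assms by (simp add: simple_graph_def)
  then show ?case
    by (simp add: machine_alg_def map_pmf_def Pi_pmf_bind[where d' = d] encode_states_def)
next
  case (Suc t)
  let ?A = "machine_alg coin init msg step out"
  let ?r = "machine_run init msg step out E"
  have "finite V" using assms by (simp add: simple_graph_def)
  have "congest_round ?A V E (encode_states V (?r \<omega> t))
      = return_pmf (encode_states V (?r \<omega> (Suc t)))" for \<omega>
  proof -
    have "congest_round ?A V E (encode_states V (?r \<omega> t)) =
      Pi_pmf V undefined (\<lambda>v. return_pmf (to_nat (?r \<omega> (Suc t) v)))"
      unfolding congest_round_def message_machine_alg[OF assms]
      by (intro Pi_pmf_cong) (auto simp: machine_alg_def encode_states_def Let_def)
    also have "\<dots> = return_pmf (encode_states V (?r \<omega> (Suc t)))"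
      using \<open>finite V\<close> by (simp add: encode_states_def fun_eq_iff)
    finally show ?thesis .
  qed
  then show ?case
    by (simp add: Suc.IH bind_map_pmf del: machine_run.simps) (simp add: map_pmf_def)
qed

section \<open>Flooding and termination detection\<close>

lemma neighbours_adj_rel: "u \<in> neighbours E v \<longleftrightarrow> (u, v) \<in> adj_rel E"
  by (simp add: neighbours_def adj_rel_def)

lemma adj_rel_sym: "(u, v) \<in> adj_rel E \<longleftrightarrow> (v, u) \<in> adj_rel E"
  by (simp add: adj_rel_def insert_commute)

lemma neighbours_sym: "u \<in> neighbours E v \<longleftrightarrow> v \<in> neighbours E u"
  by (simp add: neighbours_def insert_commute)

lemma sym_adj_rel: "sym (adj_rel E)"
  by (simp add: sym_def adj_rel_def insert_commute)

lemma adj_rtrancl_sym: "(u, v) \<in> (adj_rel E)\<^sup>* \<Longrightarrow> (v, u) \<in> (adj_rel E)\<^sup>*"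
  by (meson sym_adj_rel sym_rtrancl symD)

lemma adj_rel_mono: "E \<subseteq> E' \<Longrightarrow> adj_rel E \<subseteq> adj_rel E'"
  by (auto simp: adj_rel_def)

lemma simple_graph_subset: "simple_graph V E \<Longrightarrow> R \<subseteq> E \<Longrightarrow> simple_graph V R"
  by (auto simp: simple_graph_def)

lemma neighbours_subset: "simple_graph V E \<Longrightarrow> neighbours E v \<subseteq> V"
  using simple_graph_edgeD by (auto simp: neighbours_def)

lemma neighbours_vertexD:
  assumes "simple_graph V E" "u \<in> neighbours E v"
  shows "u \<in> V" "v \<in> V"
  using simple_graph_edgeD[OF assms(1), of u v] assms(2) by (auto simp: neighbours_def)

lemma finite_neighbours: "simple_graph V E \<Longrightarrow> finite (neighbours E v)"
  using neighbours_subset finite_subset unfolding simple_graph_def by metis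

lemma finite_edges: "simple_graph V E \<Longrightarrow> finite E"
  unfolding simple_graph_def by (rule finite_subset[of _ "Pow V"]) auto


section \<open>Balls around a vertex\<close>

primrec nball :: "nat set set \<Rightarrow> nat \<Rightarrow> nat \<Rightarrow> nat set" where
  "nball E 0 v = {v}"
| "nball E (Suc t) v = nball E t v \<union> (\<Union>u\<in>neighbours E v. nball E t u)"

lemma nball_mono: "s \<le> t \<Longrightarrow> nball E s v \<subseteq> nball E t v"
  by (induction t) (auto simp: le_Suc_eq)

lemma nball_trans: "u \<in> nball E s v \<Longrightarrow> w \<in> nball E t u \<Longrightarrow> w \<in> nball E (s + t) v"
  by (induction s arbitrary: v) auto

lemma nball_sym: "w \<in> nball E t v \<Longrightarrow> v \<in> nball E t w"
proof (induction t arbitrary: v)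
  case (Suc t)
  show ?case
  proof (cases "w \<in> nball E t v")
    case True
    then show ?thesis using Suc.IH by simp
  next
    case False
    then obtain u where u: "u \<in> neighbours E v" "w \<in> nball E t u" using Suc.prems by auto
    have "v \<in> nball E 1 u" using u(1) neighbours_sym[of u E v] by simp
    with Suc.IH[OF u(2)] have "v \<in> nball E (t + 1) w" by (rule nball_trans)
    then show ?thesis by simp
  qed
qed simp

lemma nball_relpow: "(u, v) \<in> adj_rel E ^^ k \<Longrightarrow> v \<in> nball E k u"
proof (induction k arbitrary: v)
  case (Suc k)
  then obtain w where w: "w \<in> nball E k u" "(w, v) \<in> adj_rel E" by auto
  then have "v \<in> nball E 1 w" by (simp add: neighbours_adj_rel adj_rel_sym)
  then show ?case using nball_trans[OF w(1), of v 1] by simp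
qed simp

lemma nball_subset: "simple_graph V E \<Longrightarrow> v \<in> V \<Longrightarrow> nball E t v \<subseteq> V"
  by (induction t arbitrary: v) (auto dest: neighbours_vertexD)

text \<open>A ball of radius \<open>t + 1\<close> is a union of at most \<open>d + 1\<close> balls
  of radius \<open>t\<close>.\<close>

lemma card_nball_le:
  assumes "simple_graph V E" and "\<And>v. v \<in> V \<Longrightarrow> card (neighbours E v) \<le> d" and "v \<in> V"
  shows "card (nball E t v) \<le> (d + 1) ^ t"
  using assms(3)
proof (induction t arbitrary: v)
  case (Suc t)
  have fin: "finite (neighbours E v)" using finite_neighbours assms(1) .
  have "card (nball E (Suc t) v) \<le> card (nball E t v) + card (\<Union>u\<in>neighbours E v. nball E t u)"
    by (simp add: card_Un_le)
  also have "\<dots> \<le> card (nball E t v) + (\<Sum>u\<in>neighbours E v. card (nball E t u))"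
    using card_UN_le[OF fin] by simp
  also have "\<dots> \<le> (d + 1) ^ t + (\<Sum>u\<in>neighbours E v. (d + 1) ^ t)"
    using neighbours_vertexD[OF assms(1)] Suc by (intro add_mono sum_mono) auto
  also have "\<dots> \<le> (d + 1) ^ t + d * (d + 1) ^ t"
    using assms(2)[OF Suc.prems] by simp
  finally show ?case by simp
qed simp

text \<open>Expansion stops at radius \<open>m\<close>, so the ball is a connected component.\<close>

lemma nball_closed:
  assumes "nball E (Suc m) v \<subseteq> nball E m v" and "(v, w) \<in> (adj_rel E)\<^sup>*"
  shows "w \<in> nball E m v"
  using assms(2)
proof (induction rule: rtrancl_induct)
  case base
  show ?case using nball_mono[of 0 m] by auto
next
  case (step w x)
  then have "x \<in> nball E 1 w" by (simp add: neighbours_adj_rel adj_rel_sym)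
  then have "x \<in> nball E (m + 1) v" using step by (intro nball_trans)
  then show ?case using assms(1) by auto
qed

section \<open>Flooding a maximum and the time of its last change\<close>

primrec flood :: "nat set set \<Rightarrow> (nat \<Rightarrow> nat) \<Rightarrow> nat \<Rightarrow> nat \<Rightarrow> nat" where
  "flood E f 0 v = f v"
| "flood E f (Suc t) v = Max (insert (flood E f t v) (flood E f t ` neighbours E v))"

lemma flood_ge:
  assumes "simple_graph V E" "w \<in> nball E t v"
  shows "f w \<le> flood E f t v"
  using assms(2)
proof (induction t arbitrary: v)
  case (Suc t)
  have "finite (neighbours E v)" using finite_neighbours assms(1) .
  then have "flood E f t v \<le> flood E f (Suc t) v"
    "\<And>u. u \<in> neighbours E v \<Longrightarrow> flood E f t u \<le> flood E f (Suc t) v" by auto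
  then show ?case using Suc by (auto simp del: flood.simps intro: order_trans)
qed simp

text \<open>Together with \<open>flood_ge\<close>, this identifies \<open>flood E f t v\<close> as
  the maximum of \<open>f\<close> over the ball of radius \<open>t\<close> around
  \<open>v\<close>.\<close>

lemma flood_attained:
  assumes "simple_graph V E"
  shows "\<exists>w\<in>nball E t v. flood E f t v = f w"
proof (induction t arbitrary: v)
  case (Suc t)
  have "finite (neighbours E v)" using finite_neighbours assms(1) .
  then have "flood E f (Suc t) v \<in> insert (flood E f t v) (flood E f t ` neighbours E v)"
    unfolding flood.simps by (intro Max_in) auto
  then obtain u where "u = v \<or> u \<in> neighbours E v" "flood E f (Suc t) v = flood E f t u"
    by (auto simp del: flood.simps)
  with Suc[of u] show ?case by (auto simp del: flood.simps)
qed simp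

lemma flood_mono: "simple_graph V E \<Longrightarrow> s \<le> t \<Longrightarrow> flood E f s v \<le> flood E f t v"
  by (metis flood_attained flood_ge nball_mono subsetD)

abbreviation max_id :: "nat set set \<Rightarrow> nat \<Rightarrow> nat \<Rightarrow> nat" where
  "max_id E \<equiv> flood E (\<lambda>v. v)"

text \<open>The latest change of a largest known id that \<open>v\<close> has heard of; these times
  are flooded too. A change at \<open>v\<close> itself yields \<open>Suc t\<close>, which exceeds
  everything flooded before.\<close>

primrec last_change :: "nat set set \<Rightarrow> nat \<Rightarrow> nat \<Rightarrow> nat" where
  "last_change E 0 v = 0"
| "last_change E (Suc t) v =
     (if max_id E (Suc t) v \<noteq> max_id E t v then Suc t
      else Max (insert (last_change E t v) (last_change E t ` neighbours E v)))"

lemma last_change_le_time: "simple_graph V E \<Longrightarrow> last_change E t v \<le> t"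
  by (induction t arbitrary: v)
    (auto simp: finite_neighbours le_SucI simp del: flood.simps)

lemma last_change_neighbour:
  assumes "simple_graph V E" "u = v \<or> u \<in> neighbours E v"
  shows "last_change E t u \<le> last_change E (Suc t) v"
  using assms finite_neighbours[OF assms(1), of v] last_change_le_time[OF assms(1), of t u]
  by (auto simp del: flood.simps)

text \<open>News of a change travels one edge per round and can only be superseded by later
  news.\<close>

lemma last_change_ball:
  assumes "simple_graph V E" "w \<in> nball E r v"
  shows "last_change E t w \<le> last_change E (t + r) v"
  using assms(2)
proof (induction r arbitrary: v)
  case (Suc r)
  then obtain u where "w \<in> nball E r u" "u = v \<or> u \<in> neighbours E v" by auto
  then show ?case
    using Suc.IH[of u] last_change_neighbour[OF assms(1), of u v "t + r"] by simp
qed simp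

section \<open>Termination detection in a connected graph\<close>

locale connected_graph =
  fixes V :: "nat set" and E :: "nat set set"
  assumes graph: "simple_graph V E" and conn: "graph_connected V E"
begin

lemma finV: "finite V" and neV: "V \<noteq> {}"
  using graph by (auto simp: simple_graph_def)

lemma nball_diameter: "v \<in> V \<Longrightarrow> nball E (graph_diameter V E) v = V"
proof
  assume v: "v \<in> V"
  show "nball E (graph_diameter V E) v \<subseteq> V" using nball_subset[OF graph v] .
  show "V \<subseteq> nball E (graph_diameter V E) v"
  proof
    fix w assume w: "w \<in> V"
    then have "(v, w) \<in> (adj_rel E)\<^sup>*" using v conn by (auto simp: graph_connected_def)
    then have "(v, w) \<in> adj_rel E ^^ graph_dist E v w"
      unfolding graph_dist_def using rtrancl_imp_relpow LeastI_ex by metis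
    moreover have "graph_dist E v w \<le> graph_diameter V E"
      unfolding graph_diameter_def
    proof (rule Max_ge)
      have "{graph_dist E u v |u v. u \<in> V \<and> v \<in> V} = (\<lambda>(u, v). graph_dist E u v) ` (V \<times> V)"
        by auto
      then show "finite {graph_dist E u v |u v. u \<in> V \<and> v \<in> V}" using finV by simp
    qed (use v w in auto)
    ultimately show "w \<in> nball E (graph_diameter V E) v"
      using nball_relpow nball_mono by blast
  qed
qed

definition top_id where "top_id = Max V"

lemma max_id_le: "v \<in> V \<Longrightarrow> max_id E t v \<le> top_id"
  using flood_attained[OF graph, of t v "\<lambda>v. v"] nball_subset[OF graph, of v t] finV
  unfolding top_id_def by auto

text \<open>This is the eccentricity of \<open>top_id\<close>.\<close>

definition settle where "settle = (LEAST d. \<forall>v\<in>V. max_id E d v = top_id)"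

lemma top_id_in: "top_id \<in> V"
  unfolding top_id_def using finV neV by simp

lemma max_id_diameter: "v \<in> V \<Longrightarrow> max_id E (graph_diameter V E) v = top_id"
  using flood_ge[OF graph, of top_id _ v "\<lambda>v. v"] nball_diameter[of v] top_id_in max_id_le[of v]
  by (simp add: le_antisym)

lemma max_id_settle: "v \<in> V \<Longrightarrow> max_id E settle v = top_id"
  unfolding settle_def using LeastI_ex[of "\<lambda>d. \<forall>v\<in>V. max_id E d v = top_id"] max_id_diameter
  by blast

lemma settle_le_diameter: "settle \<le> graph_diameter V E"
  unfolding settle_def using max_id_diameter by (intro Least_le) auto

lemma max_id_settled: "settle \<le> t \<Longrightarrow> v \<in> V \<Longrightarrow> max_id E t v = top_id"
  using max_id_settle flood_mono[OF graph] max_id_le by (metis le_antisym)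

lemma last_change_le_settle: "v \<in> V \<Longrightarrow> last_change E t v \<le> settle"
proof (induction t arbitrary: v)
  case (Suc t)
  show ?case
  proof (cases "max_id E (Suc t) v = max_id E t v")
    case True
    have "last_change E t u \<le> settle" if "u = v \<or> u \<in> neighbours E v" for u
      using that Suc neighbours_vertexD[OF graph] by blast
    then show ?thesis using True finite_neighbours[OF graph] by (simp del: flood.simps)
  next
    case False
    then have "\<not> settle \<le> t" using max_id_settled[of t v] max_id_settled[of "Suc t" v] Suc.prems
      by auto
    then show ?thesis using False by (simp del: flood.simps)
  qed
qed simp

text \<open>A vertex that has seen no change since round \<open>d\<close> for twice as long as it took to get there
  knows that all vertices around it agree on a leader within distance \<open>d\<close>; hence its ball of
  radius \<open>2 d + 1\<close> is no larger than that of radius \<open>2 d\<close>, and so everybody agrees.\<close>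

lemma last_change_eq_settle:
  assumes v: "v \<in> V" and stop: "3 * last_change E t v + 2 \<le> t"
  shows "last_change E t v = settle"
proof -
  define d where "d = last_change E t v"
  \<comment> \<open>A change in round \<open>Suc d\<close> within distance \<open>r\<close> of
    \<open>v\<close> would be known to \<open>v\<close> by round \<open>t\<close>. Since
    \<open>d\<close> is the latest change known there, the whole \<open>r\<close>-ball is quiet in
    round \<open>Suc d\<close>.\<close>
  define r where "r = t - Suc d"
  have r: "r \<ge> 2 * d + 1" "t = Suc d + r" using stop unfolding r_def d_def by auto
  have no_change: "max_id E (Suc d) w = max_id E d w" if "w \<in> nball E r v" for w
  proof (rule ccontr)
    assume "max_id E (Suc d) w \<noteq> max_id E d w"
    then have "last_change E (Suc d) w = Suc d" by (simp del: flood.simps)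
    then have "Suc d \<le> last_change E t v"
      using last_change_ball[OF graph that, of "Suc d"] r by simp
    then show False by (simp add: d_def)
  qed
  \<comment> \<open>A larger id at a neighbour would have changed the one at \<open>w\<close> in
    round \<open>Suc d\<close>.\<close>
  have le: "max_id E d u \<le> max_id E d w" if "w \<in> nball E r v" "u \<in> neighbours E w" for u w
  proof -
    have "max_id E d u \<le> max_id E (Suc d) w"
      using that(2) finite_neighbours[OF graph] by simp
    then show ?thesis using no_change[OF that(1)] by simp
  qed
  have agree: "max_id E d w = max_id E d u" if "w \<in> nball E s u" "nball E s u \<subseteq> nball E r v"
    for s u w
    using that
  proof (induction s arbitrary: u)
    case (Suc s)
    then consider "w \<in> nball E s u" | x where "x \<in> neighbours E u" "w \<in> nball E s x" by auto
    then show ?case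
    proof cases
      case 1
      moreover have "nball E s u \<subseteq> nball E r v" using Suc.prems(2) by auto
      ultimately show ?thesis by (rule Suc.IH)
    next
      case 2
      have "u \<in> nball E r v" using Suc.prems nball_mono[of 0 "Suc s" E u] by auto
      moreover have "x \<in> nball E r v"
        using Suc.prems(2) nball_mono[of 0 s E x] 2(1) by auto
      ultimately have "max_id E d x = max_id E d u"
        using le[of u x] le[of x u] 2(1) neighbours_sym[of u E x] by (simp add: le_antisym)
      moreover have "max_id E d w = max_id E d x"
      proof (rule Suc.IH[OF 2(2)])
        show "nball E s x \<subseteq> nball E r v" using Suc.prems(2) 2(1) by auto
      qed
      ultimately show ?thesis by simp
    qed
  qed simp
  define x where "x = max_id E d v"
  have eq_x: "max_id E d w = x" if "w \<in> nball E r v" for w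
    unfolding x_def using that order_refl by (rule agree)
  have near: "x \<in> nball E d w" if "w \<in> nball E r v" for w
  proof -
    obtain w' where "w' \<in> nball E d w" "max_id E d w = w'"
      using flood_attained[OF graph] by blast
    then show ?thesis using eq_x[OF that] by simp
  qed
  have "v \<in> nball E r v" using nball_mono[of 0 r E v] by auto
  then have xv: "x \<in> nball E d v" by (rule near)
  \<comment> \<open>Every vertex of the \<open>r\<close>-ball is within \<open>d\<close> of the
    common leader \<open>x\<close>, and so is \<open>v\<close>; hence the \<open>r\<close>-ball fits
    into radius \<open>2 * d\<close>. As \<open>r\<close> exceeds \<open>2 * d\<close>, the ball has
    stopped growing.\<close>
  have "nball E (Suc (2 * d)) v \<subseteq> nball E r v"
    using r by (intro nball_mono) auto
  moreover have "nball E r v \<subseteq> nball E (2 * d) v"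
  proof
    fix w assume "w \<in> nball E r v"
    then have "w \<in> nball E d x" using near nball_sym by blast
    then show "w \<in> nball E (2 * d) v" using nball_trans[OF xv] by (simp add: mult_2)
  qed
  ultimately have closed: "nball E (Suc (2 * d)) v \<subseteq> nball E (2 * d) v" by (rule order_trans)
  have "V \<subseteq> nball E r v"
  proof
    fix w assume "w \<in> V"
    then have "w \<in> nball E (2 * d) v"
      using closed conn v by (intro nball_closed) (auto simp: graph_connected_def)
    then show "w \<in> nball E r v" using nball_mono[of "2 * d" r] r by auto
  qed
  then have all_x: "max_id E d w = x" if "w \<in> V" for w using eq_x that by auto
  have "top_id \<le> max_id E d top_id"
    using flood_ge[OF graph, of top_id d top_id "\<lambda>v. v"] nball_mono[of 0 d E top_id] by auto
  then have "x = top_id" using all_x[OF top_id_in] max_id_le[OF top_id_in, of d] by simp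
  then have "settle \<le> d" unfolding settle_def using all_x by (intro Least_le) auto
  then show ?thesis using last_change_le_settle[OF v, of t] by (simp add: d_def)
qed

text \<open>The test reads local data only, yet it succeeds at all vertices in the same round, so
  the later phases stay synchronous.\<close>

lemma stop_iff: "v \<in> V \<Longrightarrow> 3 * last_change E t v + 2 \<le> t \<longleftrightarrow> 3 * settle + 2 \<le> t"
  using last_change_eq_settle[of v t] last_change_le_settle[of v t] by auto

section \<open>The maximum degree and the truncation level\<close>

definition max_degree where "max_degree = Max ((\<lambda>v. card (neighbours E v)) ` V)"

lemma nball_settle: "v \<in> V \<Longrightarrow> v \<in> nball E settle top_id"
  using flood_attained[OF graph, of settle v "\<lambda>v. v"] max_id_settle[of v] nball_sym by auto

text \<open>Any two vertices are within distance \<open>2 * settle\<close> of each other, by way of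
  \<open>top_id\<close>. The stopping round \<open>3 * settle + 2\<close> is late enough for
  this.\<close>

lemma flood_degree:
  assumes "v \<in> V" "2 * settle \<le> t"
  shows "flood E (\<lambda>v. card (neighbours E v)) t v = max_degree"
proof (rule antisym)
  show "flood E (\<lambda>v. card (neighbours E v)) t v \<le> max_degree"
    using flood_attained[OF graph, of t v "\<lambda>v. card (neighbours E v)"] nball_subset[OF graph assms(1)]
      finV unfolding max_degree_def by (auto intro!: Max_ge)
  have "max_degree \<in> (\<lambda>v. card (neighbours E v)) ` V"
    unfolding max_degree_def using finV neV by (intro Max_in) auto
  then obtain w where w: "w \<in> V" "max_degree = card (neighbours E w)" by auto
  have "w \<in> nball E (settle + settle) v"
    using nball_trans[OF nball_sym[OF nball_settle[OF assms(1)]] nball_settle[OF w(1)]] .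
  then have "w \<in> nball E t v" using nball_mono[of "settle + settle" t] assms by auto
  from flood_ge[OF graph this, of "\<lambda>v. card (neighbours E v)"]
  show "max_degree \<le> flood E (\<lambda>v. card (neighbours E v)) t v" using w by simp
qed

text \<open>The truncation level. The bit length is a locally computable upper bound for the binary
  logarithm of \<open>max_degree + 1\<close>, so \<open>2 ^ radius\<close> dominates the ball size
  \<open>(max_degree + 1) ^ settle\<close>.\<close>

definition radius where "radius = settle * length (bits (Suc max_degree))"

lemma card_le_radius: "card V \<le> 2 ^ radius"
proof -
  have "card V \<le> card (nball E settle top_id)"
    using nball_settle finite_subset[OF nball_subset[OF graph top_id_in] finV] by (intro card_mono) auto
  also have "\<dots> \<le> (max_degree + 1) ^ settle"
    using finV top_id_in unfolding max_degree_def by (intro card_nball_le[OF graph]) auto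
  also have "\<dots> \<le> (2 ^ length (bits (Suc max_degree))) ^ settle"
    using less_power_length_bits[of "Suc max_degree"] by (intro power_mono) auto
  finally show ?thesis by (simp add: radius_def mult.commute flip: power_mult)
qed

end

section \<open>Clustering with shifted distances\<close>

lemma mult_diff_Suc: "k < n \<Longrightarrow> (n - k) * m = (n - Suc k) * m + (m :: nat)"
  by (metis Suc_diff_Suc add.commute mult_Suc)

text \<open>A label \<open>m * K + c\<close> encodes the shifted distance \<open>m\<close> and the cluster centre \<open>c < K\<close>, so that
  the order on labels is lexicographic. All shifted distances are raised by \<open>L\<close> to keep them
  nonnegative during \<open>L\<close> rounds.\<close>

primrec label :: "nat set set \<Rightarrow> nat \<Rightarrow> nat \<Rightarrow> (nat \<Rightarrow> nat) \<Rightarrow> nat \<Rightarrow> nat \<Rightarrow> nat" where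
  "label R K L r 0 v = (L + r v) * K + v"
| "label R K L r (Suc s) v =
     Max (insert (label R K L r s v) ((\<lambda>u. label R K L r s u - K) ` neighbours R v))"

text \<open>Choosing the largest label makes the edge picked inside a vertex's own cluster lead
  towards the centre.\<close>

definition pick :: "nat \<Rightarrow> nat set \<Rightarrow> (nat \<Rightarrow> nat) \<Rightarrow> nat \<Rightarrow> nat" where
  "pick K N y c = (SOME p. p \<in> N \<and> y p mod K = c \<and> (\<forall>q\<in>N. y q mod K = c \<longrightarrow> y q \<le> y p))"

definition picks :: "nat \<Rightarrow> nat set \<Rightarrow> (nat \<Rightarrow> nat) \<Rightarrow> nat set" where
  "picks K N y = pick K N y ` (\<lambda>p. y p mod K) ` N"

definition layer :: "nat set \<Rightarrow> nat set set \<Rightarrow> nat \<Rightarrow> nat \<Rightarrow> (nat \<Rightarrow> nat) \<Rightarrow> nat set set" where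
  "layer V R K L r = {{v, p} | v p. v \<in> V \<and> p \<in> picks K (neighbours R v) (label R K L r L)}"

lemma pick_props:
  assumes "finite N" "c \<in> (\<lambda>p. y p mod K) ` N"
  shows "pick K N y c \<in> N" "y (pick K N y c) mod K = c"
    "\<And>q. q \<in> N \<Longrightarrow> y q mod K = c \<Longrightarrow> y q \<le> y (pick K N y c)"
proof -
  let ?S = "{p \<in> N. y p mod K = c}"
  have "finite (y ` ?S)" "y ` ?S \<noteq> {}" using assms by auto
  from Max_in[OF this] obtain p where "p \<in> ?S" "y p = Max (y ` ?S)" by auto
  then have "\<exists>p. p \<in> N \<and> y p mod K = c \<and> (\<forall>q\<in>N. y q mod K = c \<longrightarrow> y q \<le> y p)"
    using \<open>finite (y ` ?S)\<close> by (intro exI[of _ p]) auto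
  from someI_ex[OF this] show "pick K N y c \<in> N" "y (pick K N y c) mod K = c"
    "\<And>q. q \<in> N \<Longrightarrow> y q mod K = c \<Longrightarrow> y q \<le> y (pick K N y c)"
    unfolding pick_def by blast+
qed

lemma picks_subset: "finite N \<Longrightarrow> picks K N y \<subseteq> N"
  unfolding picks_def using pick_props(1) by blast

locale clustering =
  fixes V :: "nat set" and R :: "nat set set" and K L :: nat and r :: "nat \<Rightarrow> nat"
  assumes graph: "simple_graph V R"
    and V_less: "v \<in> V \<Longrightarrow> v < K"
    and r_le: "v \<in> V \<Longrightarrow> r v \<le> L"
begin

abbreviation "y \<equiv> label R K L r"

lemma fin: "finite (neighbours R v)"
  using finite_neighbours[OF graph] .

text \<open>A candidate centre \<open>u\<close> offers its label along every walk, losing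
  \<open>K\<close>, one unit of shifted distance, per edge. The subtraction does not truncate
  because \<open>k \<le> L\<close>.\<close>

lemma label_ge_walk:
  assumes "(u, v) \<in> adj_rel R ^^ k" "k \<le> s" "s \<le> L"
  shows "(L + r u - k) * K + u \<le> y s v"
  using assms
proof (induction s arbitrary: k v)
  case (Suc s)
  show ?case
  proof (cases "k \<le> s")
    case True
    then have "(L + r u - k) * K + u \<le> y s v" using Suc by simp
    also have "\<dots> \<le> y (Suc s) v" using fin by simp
    finally show ?thesis .
  next
    case False
    then have k: "k = Suc s" using Suc.prems by simp
    then obtain w where w: "(u, w) \<in> adj_rel R ^^ s" "(w, v) \<in> adj_rel R"
      using Suc.prems(1) by auto
    have "(L + r u - s) * K + u \<le> y s w"
      using Suc w by simp
    moreover have "(L + r u - s) * K = (L + r u - k) * K + K"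
      using k Suc.prems mult_diff_Suc[of s "L + r u" K] by simp
    ultimately have "(L + r u - k) * K + u \<le> y s w - K" by simp
    also have "\<dots> \<le> y (Suc s) v"
      using fin w(2) by (simp add: neighbours_adj_rel Max_ge)
    finally show ?thesis .
  qed
qed simp

text \<open>Conversely, every label has arrived along some walk; with \<open>label_ge_walk\<close>
  it is the best offer received.\<close>

lemma label_walk:
  assumes "v \<in> V" "s \<le> L"
  shows "\<exists>u k. u \<in> V \<and> k \<le> s \<and> (u, v) \<in> adj_rel R ^^ k \<and> y s v = (L + r u - k) * K + u"
  using assms
proof (induction s arbitrary: v)
  case (Suc s)
  let ?S = "insert (y s v) ((\<lambda>u. y s u - K) ` neighbours R v)"
  have "Max ?S \<in> ?S" using fin by (intro Max_in) auto
  then consider "y (Suc s) v = y s v" | w where "w \<in> neighbours R v" "y (Suc s) v = y s w - K"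
    by auto
  then show ?case
  proof cases
    case 1
    then show ?thesis using Suc.IH[of v] Suc.prems by (metis Suc_leD le_SucI)
  next
    case 2
    then have "w \<in> V" using neighbours_subset[OF graph] by auto
    then obtain u k where u: "u \<in> V" "k \<le> s" "(u, w) \<in> adj_rel R ^^ k"
      "y s w = (L + r u - k) * K + u"
      using Suc.IH[of w] Suc.prems by auto
    have "(L + r u - k) * K = (L + r u - Suc k) * K + K"
      using u Suc.prems by (intro mult_diff_Suc) simp
    then have "y (Suc s) v = (L + r u - Suc k) * K + u"
      using 2 u by simp
    moreover have "(u, v) \<in> adj_rel R ^^ Suc k"
      using u(3) 2(1) by (auto simp: neighbours_adj_rel)
    ultimately show ?thesis
      using u by (intro exI[of _ u] exI[of _ "Suc k"]) auto
  qed
qed auto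

lemma label_bound: "v \<in> V \<Longrightarrow> s \<le> L \<Longrightarrow> y s v < (2 * L + 1) * K"
proof -
  assume "v \<in> V" "s \<le> L"
  from label_walk[OF this] obtain u k where
    u: "u \<in> V" "y s v = (L + r u - k) * K + u" by auto
  have "L + r u - k \<le> 2 * L" using r_le[OF u(1)] by simp
  then have "(L + r u - k) * K \<le> 2 * L * K" by (rule mult_right_mono) simp
  moreover have "(2 * L + 1) * K = 2 * L * K + K" by simp
  ultimately show ?thesis using u V_less[OF u(1)] by linarith
qed

text \<open>Stopping after \<open>L\<close> rounds does no harm. A label that needed all
  \<open>L\<close> rounds to reach \<open>p\<close> has shifted distance at most \<open>L\<close>,
  which the initial label of \<open>v\<close> matches up to \<open>K\<close>; a label that needed
  fewer rounds had time for one more edge.\<close>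

lemma label_neighbour_le:
  assumes "p \<in> neighbours R v"
  shows "y L p \<le> y L v + K"
proof -
  have pV: "p \<in> V" and vV: "v \<in> V"
    using neighbours_vertexD[OF graph assms] .
  obtain u k where u: "u \<in> V" "k \<le> L" "(u, p) \<in> adj_rel R ^^ k" "y L p = (L + r u - k) * K + u"
    using label_walk[OF pV order.refl] by auto
  show ?thesis
  proof (cases "k = L")
    case True
    then have "y L p \<le> L * K + u" using u r_le by simp
    also have "\<dots> \<le> (L + r v) * K + v + K"
      using V_less[OF u(1)] by (simp add: algebra_simps)
    also have "\<dots> \<le> y L v + K"
      using label_ge_walk[of v v 0 L] by simp
    finally show ?thesis .
  next
    case False
    have "(u, v) \<in> adj_rel R ^^ Suc k"
      using u(3) assms by (auto simp: neighbours_adj_rel)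
    then have "(L + r u - Suc k) * K + u \<le> y L v"
      using False u by (intro label_ge_walk) auto
    moreover have "(L + r u - k) * K = (L + r u - Suc k) * K + K"
      using False u by (intro mult_diff_Suc) simp
    ultimately show ?thesis using u by simp
  qed
qed

definition centre where "centre v = y L v mod K"

text \<open>The predecessor of \<open>v\<close> on the walk that brought its label has a label
  larger by at least \<open>K\<close>, and by \<open>label_neighbour_le\<close> by no more.\<close>

lemma centre_cases:
  assumes "v \<in> V"
  shows "centre v = v \<or> (\<exists>p \<in> neighbours R v. y L p = y L v + K)"
proof -
  obtain u k where u: "u \<in> V" "k \<le> L" "(u, v) \<in> adj_rel R ^^ k" "y L v = (L + r u - k) * K + u"
    using label_walk[OF assms order.refl] by auto
  show ?thesis
  proof (cases k)
    case 0
    then show ?thesis using u V_less by (auto simp: centre_def)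
  next
    case (Suc k')
    then obtain p where p: "(u, p) \<in> adj_rel R ^^ k'" "(p, v) \<in> adj_rel R"
      using u by auto
    have "(L + r u - k') * K + u \<le> y L p"
      using p Suc u by (intro label_ge_walk) auto
    moreover have "(L + r u - k') * K = (L + r u - k) * K + K"
      using Suc u mult_diff_Suc[of k' "L + r u" K] by simp
    moreover have "y L p \<le> y L v + K"
      using p by (intro label_neighbour_le) (simp add: neighbours_adj_rel)
    ultimately have "y L p = y L v + K" using u by linarith
    then show ?thesis using p by (auto simp: neighbours_adj_rel)
  qed
qed

abbreviation "H \<equiv> layer V R K L r"

lemma pick_in_layer:
  assumes "v \<in> V" "p \<in> neighbours R v"
  shows "(v, pick K (neighbours R v) (y L) (centre p)) \<in> adj_rel H"
  using assms unfolding adj_rel_def layer_def picks_def centre_def by blast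

text \<open>A vertex that is not its own centre picks a neighbour in its own cluster whose label is
  larger by at least \<open>K\<close>. Labels are bounded, so following these picks ends at the
  centre.\<close>

lemma reach_centre: "v \<in> V \<Longrightarrow> (v, centre v) \<in> (adj_rel H)\<^sup>*"
proof (induction "(2 * L + 1) * K - y L v" arbitrary: v rule: less_induct)
  case less
  show ?case
  proof (cases "centre v = v")
    case False
    then obtain p where p: "p \<in> neighbours R v" "y L p = y L v + K"
      using centre_cases[OF less.prems] by auto
    have cp: "centre p = centre v" using p by (simp add: centre_def)
    let ?q = "pick K (neighbours R v) (y L) (centre p)"
    have q: "?q \<in> neighbours R v" "centre ?q = centre p" "y L p \<le> y L ?q"
      using pick_props[OF fin, of "centre p" "y L" K v] p(1) by (auto simp: centre_def)
    have "K > 0" using V_less[OF less.prems] by simp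
    moreover have "y L v < (2 * L + 1) * K" using label_bound[OF less.prems] by simp
    ultimately have "(2 * L + 1) * K - y L ?q < (2 * L + 1) * K - y L v"
      using p q(3) by linarith
    moreover have "?q \<in> V" using q(1) neighbours_subset[OF graph] by auto
    ultimately have "(?q, centre v) \<in> (adj_rel H)\<^sup>*"
      using less.hyps[of ?q] q(2) cp by simp
    with pick_in_layer[OF less.prems p(1)] show ?thesis
      by (meson converse_rtrancl_into_rtrancl)
  qed simp
qed

text \<open>The vertex \<open>v\<close> picks an edge into the cluster of \<open>u\<close>; the far
  end of this edge and \<open>u\<close> both reach their common centre.\<close>

lemma layer_connects:
  assumes "{u, v} \<in> R"
  shows "(u, v) \<in> (adj_rel H)\<^sup>*"
proof -
  have V: "u \<in> V" "v \<in> V" using simple_graph_edgeD[OF graph assms] by auto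
  have n: "u \<in> neighbours R v" using assms by (simp add: neighbours_def)
  let ?q = "pick K (neighbours R v) (y L) (centre u)"
  have q: "?q \<in> neighbours R v" "centre ?q = centre u"
    using pick_props[OF fin, of "centre u" "y L" K v] n by (auto simp: centre_def)
  have "(v, ?q) \<in> (adj_rel H)\<^sup>*" using pick_in_layer[OF V(2) n] by auto
  moreover have "(?q, centre u) \<in> (adj_rel H)\<^sup>*"
    using reach_centre[of ?q] q neighbours_subset[OF graph] by auto
  moreover have "(centre u, u) \<in> (adj_rel H)\<^sup>*"
    using adj_rtrancl_sym[OF reach_centre[OF V(1)]] .
  ultimately show ?thesis
    using adj_rtrancl_sym rtrancl_trans by metis
qed

lemma layer_subset: "H \<subseteq> R"
  using picks_subset[OF fin] unfolding layer_def
  by (auto simp: neighbours_def insert_commute)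

lemma card_layer_le: "card H \<le> (\<Sum>v\<in>V. card (centre ` neighbours R v))"
proof -
  have finV: "finite V" using graph by (simp add: simple_graph_def)
  have "H = (\<Union>v\<in>V. (\<lambda>p. {v, p}) ` picks K (neighbours R v) (y L))"
    unfolding layer_def by auto
  then have "card H \<le> (\<Sum>v\<in>V. card ((\<lambda>p. {v, p}) ` picks K (neighbours R v) (y L)))"
    using card_UN_le[OF finV] by simp
  also have "\<dots> \<le> (\<Sum>v\<in>V. card (centre ` neighbours R v))"
  proof (rule sum_mono)
    fix v
    have "card ((\<lambda>p. {v, p}) ` picks K (neighbours R v) (y L))
        \<le> card (picks K (neighbours R v) (y L))"
      unfolding picks_def using fin by (intro card_image_le) auto
    also have "\<dots> \<le> card (centre ` neighbours R v)"
      unfolding picks_def centre_def using fin by (intro card_image_le) auto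
    finally show "card ((\<lambda>p. {v, p}) ` picks K (neighbours R v) (y L))
      \<le> card (centre ` neighbours R v)" .
  qed
  finally show ?thesis .
qed

text \<open>Distance in \<open>R\<close>, meaningful only from vertices in
  \<open>reachable v\<close>, as \<open>R\<close> may be disconnected. Both notions are independent
  of the shifts.\<close>

definition hops where "hops v u = (LEAST k. (u, v) \<in> adj_rel R ^^ k)"

definition reachable where "reachable v = {u \<in> V. (u, v) \<in> (adj_rel R)\<^sup>*}"

lemma hops_walk: "u \<in> reachable v \<Longrightarrow> (u, v) \<in> adj_rel R ^^ hops v u"
  unfolding hops_def reachable_def by (metis (lifting) LeastI mem_Collect_eq rtrancl_imp_relpow)

text \<open>One unit of the slack 2 comes from \<open>y L v \<le> y L q + K\<close>, the other from
  the edge between \<open>q\<close> and \<open>v\<close>, which lengthens the walk from the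
  centre.\<close>

lemma adjacent_centre_competitive:
  assumes "q \<in> neighbours R v"
  shows "centre q \<in> reachable v"
    "w \<in> reachable v \<Longrightarrow> r w + hops v (centre q) \<le> r (centre q) + hops v w + 2"
proof -
  have V: "q \<in> V" "v \<in> V"
    using neighbours_vertexD[OF graph assms] .
  obtain u k where u: "u \<in> V" "k \<le> L" "(u, q) \<in> adj_rel R ^^ k" "y L q = (L + r u - k) * K + u"
    using label_walk[OF V(1) order.refl] by auto
  have c: "centre q = u" using u V_less by (simp add: centre_def)
  have uv: "(u, v) \<in> adj_rel R ^^ Suc k"
    using u(3) assms by (auto simp: neighbours_adj_rel)
  then have hu: "hops v u \<le> Suc k" unfolding hops_def by (rule Least_le)
  show "centre q \<in> reachable v"
    using c u uv relpow_imp_rtrancl unfolding reachable_def by fastforce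
  have yv: "y L v \<le> y L q + K"
    using assms by (intro label_neighbour_le) (simp add: neighbours_sym[of v])
  have main: "L + r w \<le> L + r u + j + 1 - k"
    if "w \<in> V" "(w, v) \<in> adj_rel R ^^ j" "j \<le> L" for w j
  proof -
    have "(L + r w - j) * K + w \<le> y L v" using that by (intro label_ge_walk) auto
    also have "\<dots> \<le> (L + r u - k + 1) * K + u" using yv u by simp
    finally have "(L + r w - j) * K < (L + r u - k + 2) * K"
      using V_less[OF u(1)] by simp
    then have "L + r w - j < L + r u - k + 2" by (rule mult_right_less_imp_less) simp
    then show ?thesis using that u by linarith
  qed
  show "r w + hops v (centre q) \<le> r (centre q) + hops v w + 2" if w: "w \<in> reachable v"
  proof (cases "hops v w \<le> L")
    case True
    then show ?thesis
      using main[of w "hops v w"] hops_walk[OF w] w hu c u by (auto simp: reachable_def)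
  next
    \<comment> \<open>Here \<open>w\<close> is too far away for its label to reach \<open>v\<close>,
      but then its shift cannot make up for its distance, and comparing the centre with
      \<open>v\<close> itself suffices.\<close>
    case False
    have "r w \<le> L" using w r_le by (auto simp: reachable_def)
    moreover have "L + r v \<le> L + r u + 0 + 1 - k" using V by (intro main) auto
    ultimately show ?thesis unfolding c using False hu u(2) by linarith
  qed
qed

end

section \<open>Geometric shifts\<close>

abbreviation geo :: "nat pmf" where "geo \<equiv> geometric_pmf (1/2)"

lemma measure_geo_atLeast: "measure_pmf.prob geo {a..} = (1/2) ^ a"
proof (induction a)
  case 0
  then show ?case by simp
next
  case (Suc a)
  have "{Suc a..} = {a..} - {a}" by auto
  then have "measure_pmf.prob geo {Suc a..} = measure_pmf.prob geo {a..} - measure_pmf.prob geo {a}"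
    by (simp only:) (rule measure_pmf.finite_measure_Diff, auto)
  then show ?case
    using Suc by (simp add: measure_pmf_single)
qed

text \<open>Memorylessness: raising a geometric variable by 3 divides its point probabilities by
  \<open>2 ^ 3\<close>.\<close>

lemma emeasure_geo_shift:
  assumes "\<And>k. k \<in> X \<Longrightarrow> k + 3 \<in> Y"
  shows "emeasure geo X \<le> 8 * emeasure geo Y"
proof -
  let ?M = "map_pmf (\<lambda>k. k + 3) geo"
  have pmf: "pmf ?M x \<le> 8 * pmf geo x" for x
  proof (cases "x \<ge> 3")
    case True
    have "pmf ?M ((\<lambda>k. k + 3) (x - 3)) = pmf geo (x - 3)"
      by (rule pmf_map_inj') (simp add: inj_def)
    moreover have "(1/2 :: real) ^ x = (1/2) ^ (x - 3) * (1/2) ^ 3"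
      using True by (simp flip: power_add)
    ultimately show ?thesis using True by (simp add: power3_eq_cube)
  next
    case False
    then have "pmf ?M x = 0" by (intro pmf_map_outside) auto
    then show ?thesis by simp
  qed
  have "emeasure geo X \<le> emeasure geo ((\<lambda>k. k + 3) -` Y)"
    using assms by (intro emeasure_mono) auto
  also have "\<dots> = emeasure ?M Y" by simp
  also have "\<dots> = (\<integral>\<^sup>+x. pmf ?M x \<partial>count_space Y)"
    by (simp only: nn_integral_pmf)
  also have "\<dots> \<le> (\<integral>\<^sup>+x. 8 * pmf geo x \<partial>count_space Y)"
    using pmf by (intro nn_integral_mono) (auto intro!: ennreal_leI simp del: pmf_geometric)
  also have "\<dots> = (\<integral>\<^sup>+x. 8 * ennreal (pmf geo x) \<partial>count_space Y)"
    by (simp add: ennreal_mult'' del: pmf_geometric)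
  also have "\<dots> = 8 * emeasure geo Y"
    by (subst nn_integral_cmult) (auto simp: nn_integral_pmf simp del: pmf_geometric)
  finally show ?thesis .
qed

text \<open>Isolates the coin of \<open>u\<close>, so that one shift can be moved while the others
  stay fixed.\<close>

lemma Pi_pmf_resample:
  assumes "finite V" "u \<in> V"
  shows "Pi_pmf V d (\<lambda>_. p) =
    bind_pmf (Pi_pmf (V - {u}) d (\<lambda>_. p)) (\<lambda>f. map_pmf (\<lambda>k. f(u := k)) p)"
proof -
  have "Pi_pmf V d (\<lambda>_. p) = Pi_pmf (insert u (V - {u})) d (\<lambda>_. p)"
    using assms by (simp add: insert_absorb)
  also have "\<dots> = bind_pmf p (\<lambda>k. bind_pmf (Pi_pmf (V - {u}) d (\<lambda>_. p)) (\<lambda>f. return_pmf (f(u := k))))"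
    using assms by (intro Pi_pmf_insert') auto
  finally show ?thesis
    by (subst (asm) bind_commute_pmf) (simp add: map_pmf_def)
qed

lemma emeasure_Pi_geo_shift:
  assumes "finite V" "u \<in> V"
    and "\<And>\<omega>. \<omega> \<in> X \<Longrightarrow> fun_upd \<omega> u (\<omega> u + 3) \<in> Y"
  shows "emeasure (Pi_pmf V d (\<lambda>_. geo)) X \<le> 8 * emeasure (Pi_pmf V d (\<lambda>_. geo)) Y"
proof -
  let ?Q = "Pi_pmf (V - {u}) d (\<lambda>_. geo)"
  have em: "emeasure (Pi_pmf V d (\<lambda>_. geo)) Z = (\<integral>\<^sup>+f. emeasure geo {k. f(u := k) \<in> Z} \<partial>?Q)" for Z
    by (subst Pi_pmf_resample[OF assms(1,2)]) (simp add: emeasure_bind_pmf vimage_def)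
  have "emeasure geo {k. f(u := k) \<in> X} \<le> 8 * emeasure geo {k. f(u := k) \<in> Y}" for f
  proof (rule emeasure_geo_shift)
    fix k assume "k \<in> {k. f(u := k) \<in> X}"
    then show "k + 3 \<in> {k. f(u := k) \<in> Y}" using assms(3)[of "f(u := k)"] by simp
  qed
  then show ?thesis
    unfolding em by (subst nn_integral_cmult[symmetric]) (auto intro!: nn_integral_mono)
qed

text \<open>The only non-memoryless behaviour of a truncated shift occurs for \<open>\<omega> u \<ge> L - 2\<close>; raising any
  other shift by 3 turns a competitive vertex into the strict winner.\<close>

lemma expected_competitive_le:
  fixes U V :: "'a set" and h :: "'a \<Rightarrow> nat"
  assumes V: "finite V" "U \<subseteq> V" "card V \<le> 2 ^ L"
  shows "(\<integral>\<^sup>+\<omega>. of_nat (card {u \<in> U. \<forall>w\<in>U. min (\<omega> w) L + h u \<le> min (\<omega> u) L + h w + 2})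
    \<partial>Pi_pmf V d (\<lambda>_. geo)) \<le> (12 :: ennreal)"
proof -
  let ?P = "Pi_pmf V d (\<lambda>_. geo)"
  \<comment> \<open>\<open>A u\<close>: \<open>u\<close> is within 2 of the maximum.
    \<open>S u\<close>: \<open>u\<close> wins strictly. \<open>T u\<close>: adding 3 to the shift
    may hit the truncation. The events \<open>S u\<close> are disjoint and contribute at most 8 in
    total; the events \<open>T u\<close> contribute at most
    \<open>card V * 4 / 2 ^ L \<le> 4\<close>.\<close>
  define A where "A u = {\<omega>. \<forall>w\<in>U. min (\<omega> w) L + h u \<le> min (\<omega> u) L + h w + 2}" for u
  define S where "S u = {\<omega>. \<forall>w\<in>U - {u}. min (\<omega> w) L + h u < min (\<omega> u) L + h w}" for u
  define T where "T u = {\<omega> :: 'a \<Rightarrow> nat. \<omega> u \<ge> L - 2}" for u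
  have finU: "finite U" using V finite_subset by blast
  have T: "emeasure ?P (T u) \<le> ennreal (4 / 2 ^ L)" if "u \<in> U" for u
  proof -
    have "emeasure ?P (T u) = emeasure (map_pmf (\<lambda>f. f u) ?P) {L - 2..}"
      unfolding T_def by (simp add: vimage_def)
    also have "\<dots> = emeasure geo {L - 2..}"
      using V that by (subst Pi_pmf_component) auto
    also have "\<dots> = ennreal ((1/2) ^ (L - 2))"
      by (simp only: measure_pmf.emeasure_eq_measure measure_geo_atLeast)
    also have "(1/2) ^ (L - 2) \<le> (4 / 2 ^ L :: real)"
    proof (cases "L \<ge> 2")
      case True
      then have "(2::real) ^ L = 2 ^ (L - 2) * 2 ^ 2" by (metis le_add_diff_inverse2 power_add)
      then show ?thesis by (simp add: field_simps)
    next
      case False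
      then have "L = 0 \<or> L = 1" by auto
      then show ?thesis by auto
    qed
    finally show ?thesis by (simp add: ennreal_leI)
  qed
  have A: "emeasure ?P (A u) \<le> 8 * emeasure ?P (S u) + ennreal (4 / 2 ^ L)" if u: "u \<in> U" for u
  proof -
    have "emeasure ?P (A u) \<le> emeasure ?P ((A u - T u) \<union> T u)"
      by (intro emeasure_mono) auto
    also have "\<dots> \<le> emeasure ?P (A u - T u) + emeasure ?P (T u)"
      by (intro emeasure_subadditive) auto
    also have "emeasure ?P (A u - T u) \<le> 8 * emeasure ?P (S u)"
    proof (rule emeasure_Pi_geo_shift[where u = u])
      fix \<omega> assume "\<omega> \<in> A u - T u"
      then show "fun_upd \<omega> u (\<omega> u + 3) \<in> S u"
        using u by (fastforce simp: A_def T_def S_def)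
    qed (use V u in auto)
    finally show ?thesis using T[OF u] by (meson add_mono order_refl order_trans)
  qed
  have disj: "disjoint_family_on S U"
    unfolding disjoint_family_on_def
  proof (intro ballI impI)
    fix u w assume uw: "u \<in> U" "w \<in> U" "u \<noteq> w"
    show "S u \<inter> S w = {}"
    proof (rule ccontr)
      assume "S u \<inter> S w \<noteq> {}"
      then obtain \<omega> where "\<omega> \<in> S u" "\<omega> \<in> S w" by auto
      then have "min (\<omega> w) L + h u < min (\<omega> u) L + h w" "min (\<omega> u) L + h w < min (\<omega> w) L + h u"
        using uw unfolding S_def by auto
      then show False by simp
    qed
  qed
  have sumS: "(\<Sum>u\<in>U. emeasure ?P (S u)) \<le> 1"
    using sum_emeasure[OF _ disj finU, of "measure_pmf ?P"] by (simp add: measure_pmf.emeasure_le_1)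
  have "(\<integral>\<^sup>+\<omega>. of_nat (card {u \<in> U. \<forall>w\<in>U. min (\<omega> w) L + h u \<le> min (\<omega> u) L + h w + 2}) \<partial>?P)
      = (\<integral>\<^sup>+\<omega>. (\<Sum>u\<in>U. indicator (A u) \<omega>) \<partial>?P)"
  proof (intro nn_integral_cong)
    fix \<omega>
    have "{u \<in> U. \<forall>w\<in>U. min (\<omega> w) L + h u \<le> min (\<omega> u) L + h w + 2} = {u \<in> U. \<omega> \<in> A u}"
      by (simp add: A_def)
    moreover have "of_nat (card {u \<in> U. \<omega> \<in> A u}) = (\<Sum>u\<in>U. indicator (A u) \<omega> :: ennreal)"
      using finU by (simp add: indicator_def sum.If_cases Int_def)
    ultimately show "of_nat (card {u \<in> U. \<forall>w\<in>U. min (\<omega> w) L + h u \<le> min (\<omega> u) L + h w + 2})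
      = (\<Sum>u\<in>U. indicator (A u) \<omega> :: ennreal)" by simp
  qed
  also have "\<dots> = (\<Sum>u\<in>U. emeasure ?P (A u))"
    by (subst nn_integral_sum) auto
  also have "\<dots> \<le> (\<Sum>u\<in>U. 8 * emeasure ?P (S u) + ennreal (4 / 2 ^ L))"
    by (intro sum_mono A)
  also have "\<dots> = 8 * (\<Sum>u\<in>U. emeasure ?P (S u)) + of_nat (card U) * ennreal (4 / 2 ^ L)"
    by (simp add: sum.distrib sum_distrib_left)
  also have "\<dots> \<le> 8 * 1 + ennreal 4"
  proof (intro add_mono mult_left_mono sumS)
    have "real (card U) \<le> 2 ^ L"
      using V card_mono[of V U] by (metis le_trans of_nat_le_iff of_nat_numeral of_nat_power)
    then have "real (card U) * (4 / 2 ^ L) \<le> 4" by (simp add: field_simps)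
    moreover have "of_nat (card U) * ennreal (4 / 2 ^ L) = ennreal (real (card U) * (4 / 2 ^ L))"
      unfolding ennreal_of_nat_eq_real_of_nat by (rule ennreal_mult''[symmetric]) simp
    ultimately show "of_nat (card U) * ennreal (4 / 2 ^ L) \<le> ennreal 4"
      by (simp only: ennreal_leI)
  qed auto
  finally show ?thesis by simp
qed

lemma expected_layer_le:
  assumes "simple_graph V R" "V \<subseteq> {..<K}" "card V \<le> 2 ^ L"
  shows "(\<integral>\<^sup>+\<omega>. of_nat (card (layer V R K L (\<lambda>v. min (\<omega> v) L))) \<partial>Pi_pmf V d (\<lambda>_. geo))
    \<le> of_nat (12 * card V)"
proof -
  let ?P = "Pi_pmf V d (\<lambda>_. geo)"
  have V: "finite V" using assms by (simp add: simple_graph_def)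
  \<comment> \<open>Adjacent clusters of \<open>v\<close> are counted through the larger set
    \<open>Z\<close> of competitive centres. \<open>U\<close> and \<open>h\<close> do not depend on
    the shifts, so \<open>expected_competitive_le\<close> applies at each \<open>v\<close>.\<close>
  define U where "U v = clustering.reachable V R v" for v
  define h where "h v = clustering.hops R v" for v
  define Z where "Z \<omega> v = {u \<in> U v. \<forall>w\<in>U v. min (\<omega> w) L + h v u \<le> min (\<omega> u) L + h v w + 2}" for \<omega> v
  have cl: "clustering V R K L (\<lambda>v. min (\<omega> v) L)" for \<omega>
    using assms by unfold_locales auto
  have UV: "U v \<subseteq> V" for v
    unfolding U_def clustering.reachable_def[OF cl[of "\<lambda>_. 0"]] by auto
  have le: "card (layer V R K L (\<lambda>v. min (\<omega> v) L)) \<le> (\<Sum>v\<in>V. card (Z \<omega> v))" for \<omega>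
  proof -
    interpret clustering V R K L "\<lambda>v. min (\<omega> v) L" by (rule cl)
    have "card (layer V R K L (\<lambda>v. min (\<omega> v) L)) \<le> (\<Sum>v\<in>V. card (centre ` neighbours R v))"
      by (rule card_layer_le)
    also have "\<dots> \<le> (\<Sum>v\<in>V. card (Z \<omega> v))"
    proof (intro sum_mono card_mono)
      fix v
      show "finite (Z \<omega> v)" using UV[of v] by (intro finite_subset[OF _ V]) (auto simp: Z_def)
      show "centre ` neighbours R v \<subseteq> Z \<omega> v"
        using adjacent_centre_competitive unfolding Z_def U_def h_def by auto
    qed
    finally show ?thesis .
  qed
  have "(\<integral>\<^sup>+\<omega>. of_nat (card (layer V R K L (\<lambda>v. min (\<omega> v) L))) \<partial>?P)
      \<le> (\<integral>\<^sup>+\<omega>. (\<Sum>v\<in>V. of_nat (card (Z \<omega> v))) \<partial>?P)"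
    using le by (intro nn_integral_mono) (metis of_nat_mono of_nat_sum)
  also have "\<dots> = (\<Sum>v\<in>V. \<integral>\<^sup>+\<omega>. of_nat (card (Z \<omega> v)) \<partial>?P)"
    by (subst nn_integral_sum) auto
  also have "\<dots> \<le> (\<Sum>v\<in>V. 12)"
    unfolding Z_def using V UV assms(3) by (intro sum_mono expected_competitive_le) auto
  finally show ?thesis by (simp add: mult.commute)
qed

section \<open>Disjoint layers\<close>

text \<open>A fresh shift per layer, taken from the front of the coin list, keeps the shifts
  independent of the graph \<open>R - H\<close> on which the next layer is built.\<close>

primrec layers :: "nat set \<Rightarrow> nat \<Rightarrow> nat \<Rightarrow> nat \<Rightarrow> nat set set \<Rightarrow> (nat \<Rightarrow> nat list) \<Rightarrow> nat set set" where
  "layers V K L 0 R \<omega> = {}"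
| "layers V K L (Suc k) R \<omega> =
     (let H = layer V R K L (\<lambda>v. min (hd (\<omega> v)) L)
      in H \<union> layers V K L k (R - H) (\<lambda>v. tl (\<omega> v)))"

lemma layers_subset:
  assumes "simple_graph V R" "V \<subseteq> {..<K}"
  shows "layers V K L k R \<omega> \<subseteq> R"
  using assms
proof (induction k arbitrary: R \<omega>)
  case (Suc k)
  have "clustering V R K L (\<lambda>v. min (hd (\<omega> v)) L)"
    using Suc.prems by unfold_locales auto
  then have "layer V R K L (\<lambda>v. min (hd (\<omega> v)) L) \<subseteq> R"
    by (rule clustering.layer_subset)
  moreover have "layers V K L k (R - layer V R K L (\<lambda>v. min (hd (\<omega> v)) L)) (\<lambda>v. tl (\<omega> v)) \<subseteq> R"
    using Suc.IH[OF simple_graph_subset[OF Suc.prems(1) Diff_subset] Suc.prems(2)] by blast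
  ultimately show ?case by (simp add: Let_def)
qed simp

text \<open>Each of the disjoint layers offers a detour for every edge outside all layers, and fewer than
  \<open>k\<close> removed edges cannot hit all \<open>k\<close> layers.\<close>

lemma layers_connect:
  assumes "simple_graph V R" "V \<subseteq> {..<K}" "card F < k" "finite F" "{u, v} \<in> R" "{u, v} \<notin> layers V K L k R \<omega>"
  shows "(u, v) \<in> (adj_rel (layers V K L k R \<omega> - F))\<^sup>*"
  using assms
proof (induction k arbitrary: R \<omega> F)
  case (Suc k)
  define H where "H = layer V R K L (\<lambda>v. min (hd (\<omega> v)) L)"
  define H' where "H' = layers V K L k (R - H) (\<lambda>v. tl (\<omega> v))"
  have eq: "layers V K L (Suc k) R \<omega> = H \<union> H'"
    by (simp add: Let_def H_def H'_def)
  have cl: "clustering V R K L (\<lambda>v. min (hd (\<omega> v)) L)"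
    using Suc.prems by unfold_locales auto
  have sg: "simple_graph V (R - H)" using Suc.prems(1) simple_graph_subset by blast
  show ?case
  proof (cases "F \<inter> H = {}")
    case True
    have "(u, v) \<in> (adj_rel H)\<^sup>*"
      unfolding H_def using clustering.layer_connects[OF cl] Suc.prems by blast
    then show ?thesis
      unfolding eq using True by (elim rev_subsetD) (intro rtrancl_mono adj_rel_mono, auto)
  next
    case False
    then have "card (F - H) < card F" using Suc.prems(4) by (intro psubset_card_mono) auto
    then have "(u, v) \<in> (adj_rel (H' - (F - H)))\<^sup>*"
      unfolding H'_def using Suc.prems sg eq by (intro Suc.IH) (auto simp: H'_def)
    moreover have "H' \<subseteq> R - H" unfolding H'_def by (rule layers_subset[OF sg Suc.prems(2)])
    ultimately show ?thesis
      unfolding eq by (elim rev_subsetD) (intro rtrancl_mono adj_rel_mono, auto)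
  qed
qed simp

text \<open>Each edge of \<open>E - F\<close> outside the layers has a detour avoiding
  \<open>F\<close>, so the connectivity of \<open>E - F\<close> carries over.\<close>

lemma layers_edge_connected:
  assumes "simple_graph V E" "V \<subseteq> {..<K}" "edge_connected k V E"
  shows "edge_connected k V (layers V K L k E \<omega>)"
  unfolding edge_connected_def
proof (intro allI impI)
  let ?H = "layers V K L k E \<omega>"
  fix F assume F: "F \<subseteq> ?H" "card F < k"
  have sub: "?H \<subseteq> E" using assms layers_subset by blast
  have fin: "finite F"
    by (rule finite_subset[OF order.trans[OF F(1) sub] finite_edges[OF assms(1)]])
  have conn: "graph_connected V (E - F)"
    using assms(3) F sub unfolding edge_connected_def by blast
  have "adj_rel (E - F) \<subseteq> (adj_rel (?H - F))\<^sup>*"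
  proof (clarsimp simp: adj_rel_def)
    fix u v assume e: "{u, v} \<in> E" "{u, v} \<notin> F"
    show "(u, v) \<in> {(u, v). {u, v} \<in> ?H \<and> {u, v} \<notin> F}\<^sup>*"
    proof (cases "{u, v} \<in> ?H")
      case False
      then show ?thesis
        using layers_connect[OF assms(1,2) F(2) fin e(1) False] by (simp add: adj_rel_def)
    qed (use e in auto)
  qed
  then have "(adj_rel (E - F))\<^sup>* \<subseteq> (adj_rel (?H - F))\<^sup>*"
    by (rule rtrancl_subset_rtrancl)
  then show "graph_connected V (?H - F)"
    using conn unfolding graph_connected_def by blast
qed

text \<open>The first shifts determine the remaining graph, and the other coins are independent of
  them. Conditioning on the first shifts, the bound for one layer can be added \<open>k\<close>
  times.\<close>

lemma expected_layers_le:
  assumes "simple_graph V R" "V \<subseteq> {..<K}" "card V \<le> 2 ^ L"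
  shows "(\<integral>\<^sup>+\<omega>. of_nat (card (layers V K L k R \<omega>)) \<partial>Pi_pmf V [] (\<lambda>_. replicate_pmf k geo))
    \<le> of_nat (12 * card V * k)"
  using assms(1)
proof (induction k arbitrary: R)
  case (Suc k)
  have V: "finite V" using assms by (simp add: simple_graph_def)
  \<comment> \<open>With this default, heads and tails of the joined coins agree with
    \<open>f\<close> and \<open>F\<close> outside \<open>V\<close> as well.\<close>
  let ?d = "hd [] :: nat"
  let ?P = "Pi_pmf V ?d (\<lambda>_. geo)" and ?Q = "Pi_pmf V [] (\<lambda>_. replicate_pmf k geo)"
  let ?join = "\<lambda>f F v. if v \<in> V then f v # F v else []"
  let ?l = "\<lambda>f. layer V R K L (\<lambda>v. min (f v) L)"
  have Pi: "Pi_pmf V [] (\<lambda>_. replicate_pmf (Suc k) geo) =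
      bind_pmf ?P (\<lambda>f. bind_pmf ?Q (\<lambda>F. return_pmf (?join f F)))"
    using V by (simp add: Pi_pmf_bind[where d' = ?d] Pi_pmf_bind[where d' = "[]"])
  have split: "layers V K L (Suc k) R (?join f F) = ?l f \<union> layers V K L k (R - ?l f) F"
    if "f \<in> set_pmf ?P" "F \<in> set_pmf ?Q" for f F
  proof -
    have "f v = ?d" "F v = []" if "v \<notin> V" for v
      using that \<open>f \<in> set_pmf ?P\<close> \<open>F \<in> set_pmf ?Q\<close> set_Pi_pmf_subset[OF V, of ?d "\<lambda>_. geo"]
        set_Pi_pmf_subset[OF V, of "[]" "\<lambda>_. replicate_pmf k geo"] by auto
    then have "hd (?join f F v) = f v" "tl (?join f F v) = F v" for v by auto
    then show ?thesis by (simp add: Let_def)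
  qed
  have "(\<integral>\<^sup>+\<omega>. of_nat (card (layers V K L (Suc k) R \<omega>)) \<partial>Pi_pmf V [] (\<lambda>_. replicate_pmf (Suc k) geo))
      = (\<integral>\<^sup>+f. \<integral>\<^sup>+F. of_nat (card (layers V K L (Suc k) R (?join f F))) \<partial>?Q \<partial>?P)"
    by (simp add: Pi del: layers.simps replicate_pmf.simps)
  also have "\<dots> \<le> (\<integral>\<^sup>+f. \<integral>\<^sup>+F. of_nat (card (?l f)) + of_nat (card (layers V K L k (R - ?l f) F)) \<partial>?Q \<partial>?P)"
  proof (intro nn_integral_mono_AE, simp only: AE_measure_pmf_iff, intro ballI nn_integral_mono_AE,
      simp only: AE_measure_pmf_iff, intro ballI)
    fix f F assume "f \<in> set_pmf ?P" "F \<in> set_pmf ?Q"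
    then show "of_nat (card (layers V K L (Suc k) R (?join f F)))
      \<le> of_nat (card (?l f)) + (of_nat (card (layers V K L k (R - ?l f) F)) :: ennreal)"
      by (simp only: split of_nat_add[symmetric]) (intro of_nat_mono card_Un_le)
  qed
  also have "\<dots> = (\<integral>\<^sup>+f. of_nat (card (?l f)) + (\<integral>\<^sup>+F. of_nat (card (layers V K L k (R - ?l f) F)) \<partial>?Q) \<partial>?P)"
    by (subst nn_integral_add) (auto simp: measure_pmf.emeasure_space_1)
  also have "\<dots> \<le> (\<integral>\<^sup>+f. of_nat (card (?l f)) + of_nat (12 * card V * k) \<partial>?P)"
    using Suc.prems by (intro nn_integral_mono add_left_mono Suc.IH) (auto intro: simple_graph_subset)
  also have "\<dots> = (\<integral>\<^sup>+f. of_nat (card (?l f)) \<partial>?P) + of_nat (12 * card V * k)"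
    by (subst nn_integral_add) (auto simp: measure_pmf.emeasure_space_1)
  also have "\<dots> \<le> of_nat (12 * card V) + of_nat (12 * card V * k)"
    using Suc.prems assms by (intro add_right_mono expected_layer_le) auto
  also have "\<dots> = of_nat (12 * card V * Suc k)"
    by (simp only: of_nat_add[symmetric] mult_Suc_right)
  finally show ?case .
qed simp

section \<open>The distributed algorithm\<close>

text \<open>The arguments of the three kinds of states are
  \<^item> own id, neighbours, coins, time, largest id, largest degree, time of the last known change;
  \<^item> own id, neighbours, coins, label base, radius, chosen neighbours, round, label;
  \<^item> own id, neighbours, coins, label base, radius, chosen neighbours, new picks.\<close>

datatype state =
    Explore nat "nat list" "nat list" nat nat nat nat
  | Cluster nat "nat list" "nat list" nat nat "nat list" nat nat
  | Inform nat "nat list" "nat list" nat nat "nat list" "nat list"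

instance state :: countable
  by countable_datatype

definition start_label :: "nat \<Rightarrow> nat \<Rightarrow> nat list \<Rightarrow> nat \<Rightarrow> nat" where
  "start_label K L gs v = (L + min (hd gs) L) * K + v"

text \<open>In a connected graph a vertex without neighbours is alone; its empty coin list makes it
  terminated from the start.\<close>

definition init_state :: "nat \<Rightarrow> nat set \<Rightarrow> nat list \<Rightarrow> state" where
  "init_state v N gs =
     (if N = {} then Cluster v [] [] 0 0 [] 0 0
      else Explore v (sorted_list_of_set N) gs 0 v (card N) 0)"

fun out_msg :: "state \<Rightarrow> nat \<Rightarrow> nat" where
  "out_msg (Explore v N gs t M d C) u = prod_encode (M, prod_encode (d, C))"
| "out_msg (Cluster v N gs K L H s y) u = y"
| "out_msg (Inform v N gs K L H P) u = of_bool (u \<in> set P)"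

text \<open>\<open>Explore\<close> computes the recursions of \<open>flood\<close> and
  \<open>last_change\<close>. \<open>Cluster\<close> ignores the neighbours in \<open>H\<close>,
  that is, it works on the edges left by earlier layers. A shift is dropped on entering
  \<open>Inform\<close>, whose message 1 says that the edge was picked at the sender's end.\<close>

fun next_state :: "state \<Rightarrow> (nat \<Rightarrow> nat) \<Rightarrow> state" where
  "next_state (Explore v N gs t M d C) m =
     (let M' = Max (insert M ((\<lambda>u. fst (prod_decode (m u))) ` set N));
          d' = Max (insert d ((\<lambda>u. fst (prod_decode (snd (prod_decode (m u))))) ` set N));
          C' = (if M' \<noteq> M then Suc t
                else Max (insert C ((\<lambda>u. snd (prod_decode (snd (prod_decode (m u))))) ` set N)));
          K = Suc M'; L = C' * length (bits (Suc d'))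
      in if 3 * C' + 2 \<le> Suc t then Cluster v N gs K L [] 0 (start_label K L gs v)
         else Explore v N gs (Suc t) M' d' C')"
| "next_state (Cluster v N gs K L H s y) m =
     (if s < L then Cluster v N gs K L H (Suc s) (Max (insert y ((\<lambda>u. m u - K) ` (set N - set H))))
      else Inform v N (tl gs) K L H (sorted_list_of_set (picks K (set N - set H) m)))"
| "next_state (Inform v N gs K L H P) m =
     Cluster v N gs K L (sorted_list_of_set (set H \<union> set P \<union> {u \<in> set N. m u = 1})) 0
       (start_label K L gs v)"

text \<open>An empty coin list means that all layers are done. \<open>Inform\<close> is never final,
  so the last picks are still announced.\<close>

fun solution :: "state \<Rightarrow> nat set option" where
  "solution (Cluster v N [] K L H s y) = Some (set H)"
| "solution _ = None"

abbreviation run :: "nat set set \<Rightarrow> (nat \<Rightarrow> nat list) \<Rightarrow> nat \<Rightarrow> nat \<Rightarrow> state" where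
  "run \<equiv> machine_run init_state out_msg next_state solution"

abbreviation sent :: "nat set set \<Rightarrow> (nat \<Rightarrow> nat list) \<Rightarrow> nat \<Rightarrow> nat \<Rightarrow> nat \<Rightarrow> nat" where
  "sent E \<omega> t \<equiv> machine_msg out_msg solution E (run E \<omega> t)"

lemma run_Suc: "run E \<omega> (Suc t) v =
    (if solution (run E \<omega> t v) = None then next_state (run E \<omega> t v) (\<lambda>u. sent E \<omega> t u v)
     else run E \<omega> t v)"
  by (simp add: Let_def)

lemma picks_cong:
  assumes "\<And>p. p \<in> N \<Longrightarrow> y p = y' p"
  shows "picks K N y = picks K N y'"
proof -
  have "pick K N y = pick K N y'"
    unfolding pick_def using assms by (intro ext arg_cong[where f = Eps]) auto
  then show ?thesis unfolding picks_def using assms by (auto simp: image_iff)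
qed

section \<open>Runs of the algorithm, phase by phase\<close>

context connected_graph
begin

abbreviation "nbs v \<equiv> sorted_list_of_set (neighbours E v)"

lemma set_nbs [simp]: "set (sorted_list_of_set (neighbours H v)) = neighbours H v" if "H \<subseteq> E"
  using finite_neighbours[OF simple_graph_subset[OF graph that]] by simp

lemma explore_step:
  assumes v: "v \<in> V"
    and run_t: "\<And>u. u \<in> V \<Longrightarrow> run E \<omega> t u =
      Explore u (nbs u) (\<omega> u) t (max_id E t u) (flood E (\<lambda>v. card (neighbours E v)) t u)
        (last_change E t u)"
  shows "run E \<omega> (Suc t) v =
    (let K = Suc (max_id E (Suc t) v);
         L = last_change E (Suc t) v *
           length (bits (Suc (flood E (\<lambda>v. card (neighbours E v)) (Suc t) v)))
     in if 3 * last_change E (Suc t) v + 2 \<le> Suc t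
        then Cluster v (nbs v) (\<omega> v) K L [] 0 (start_label K L (\<omega> v) v)
        else Explore v (nbs v) (\<omega> v) (Suc t) (max_id E (Suc t) v)
          (flood E (\<lambda>v. card (neighbours E v)) (Suc t) v) (last_change E (Suc t) v))"
proof -
  have sent: "sent E \<omega> t u v = prod_encode (max_id E t u,
      prod_encode (flood E (\<lambda>v. card (neighbours E v)) t u, last_change E t u))"
    if "u \<in> neighbours E v" for u
    using that run_t[of u] neighbours_vertexD[OF graph that]
    by (simp add: machine_msg_def neighbours_def)
  have im: "(\<lambda>u. fst (prod_decode (sent E \<omega> t u v))) ` neighbours E v = max_id E t ` neighbours E v"
    "(\<lambda>u. fst (prod_decode (snd (prod_decode (sent E \<omega> t u v))))) ` neighbours E v =
      flood E (\<lambda>v. card (neighbours E v)) t ` neighbours E v"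
    "(\<lambda>u. snd (prod_decode (snd (prod_decode (sent E \<omega> t u v))))) ` neighbours E v =
      last_change E t ` neighbours E v"
    using sent by (auto intro!: image_cong)
  show ?thesis
    unfolding run_Suc run_t[OF v] next_state.simps set_nbs[OF order_refl] im
    by (simp add: Let_def)
qed

lemma run_explore:
  assumes "card V \<ge> 2" "t < 3 * settle + 2" "v \<in> V"
  shows "run E \<omega> t v =
    Explore v (nbs v) (\<omega> v) t (max_id E t v) (flood E (\<lambda>v. card (neighbours E v)) t v)
      (last_change E t v)"
  using assms(2,3)
proof (induction t arbitrary: v)
  case 0
  \<comment> \<open>Connectivity and a second vertex provide a neighbour of \<open>v\<close>, so
    \<open>v\<close> starts in state \<open>Explore\<close>.\<close>
  have "V \<noteq> {v}" using assms(1) by auto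
  then obtain w where "w \<in> V" "w \<noteq> v" using 0 by blast
  then have "(v, w) \<in> (adj_rel E)\<^sup>+"
    using conn 0 unfolding graph_connected_def by (metis rtranclD)
  then obtain u where "(v, u) \<in> adj_rel E" by (meson tranclD)
  then have "u \<in> neighbours E v" using adj_rel_sym[of v u E] by (simp add: neighbours_adj_rel)
  then have "neighbours E v \<noteq> {}" by auto
  then show ?case by (simp add: init_state_def)
next
  case (Suc t)
  have "\<not> 3 * last_change E (Suc t) v + 2 \<le> Suc t"
    unfolding stop_iff[OF Suc.prems(2)] using Suc.prems(1) by simp
  then show ?case
    using explore_step[of v \<omega> t] Suc by (simp add: Let_def del: flood.simps last_change.simps machine_run.simps)
qed

lemma run_cluster_start:
  assumes "card V \<ge> 2" "v \<in> V"
  shows "run E \<omega> (3 * settle + 2) v =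
    Cluster v (nbs v) (\<omega> v) (Suc top_id) radius [] 0 (start_label (Suc top_id) radius (\<omega> v) v)"
proof -
  let ?t = "3 * settle + 1"
  have "3 * last_change E (Suc ?t) v + 2 \<le> Suc ?t" "last_change E (Suc ?t) v = settle"
    using stop_iff[OF assms(2), of "Suc ?t"] last_change_eq_settle[OF assms(2), of "Suc ?t"]
    by (simp_all del: last_change.simps)
  moreover have "max_id E (Suc ?t) v = top_id"
    using assms by (intro max_id_settled) auto
  moreover have "flood E (\<lambda>v. card (neighbours E v)) (Suc ?t) v = max_degree"
    using assms by (intro flood_degree) auto
  ultimately have "run E \<omega> (Suc ?t) v =
      Cluster v (nbs v) (\<omega> v) (Suc top_id) radius [] 0 (start_label (Suc top_id) radius (\<omega> v) v)"
    using explore_step[OF assms(2), of \<omega> ?t] run_explore[OF assms(1)]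
    by (simp add: Let_def radius_def del: flood.simps last_change.simps machine_run.simps)
  then show ?thesis by (simp del: machine_run.simps)
qed

definition at_start :: "(nat \<Rightarrow> nat list) \<Rightarrow> nat \<Rightarrow> (nat \<Rightarrow> nat list) \<Rightarrow> nat \<Rightarrow> nat \<Rightarrow> nat set set \<Rightarrow> bool" where
  "at_start \<omega> t gs K L H \<longleftrightarrow> H \<subseteq> E \<and> (\<forall>v\<in>V. run E \<omega> t v =
     Cluster v (nbs v) (gs v) K L (sorted_list_of_set (neighbours H v)) 0 (start_label K L (gs v) v))"

context
  fixes \<omega> t gs K L H r R
  assumes start: "at_start \<omega> t gs K L H" and gs: "\<And>v. v \<in> V \<Longrightarrow> gs v \<noteq> []"
    and K: "V \<subseteq> {..<K}"
  defines "r \<equiv> \<lambda>v. min (hd (gs v)) L" and "R \<equiv> E - H"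
begin

lemma HE: "H \<subseteq> E"
  using start by (simp add: at_start_def)

lemma neighbours_R: "neighbours E v - neighbours H v = neighbours R v"
  by (auto simp: neighbours_def R_def)

lemma clustering_R: "clustering V R K L r"
  using K simple_graph_subset[OF graph, of R]
  by unfold_locales (auto simp: R_def r_def)

lemma run_label:
  assumes "s \<le> L" "v \<in> V"
  shows "run E \<omega> (t + s) v =
    Cluster v (nbs v) (gs v) K L (sorted_list_of_set (neighbours H v)) s (label R K L r s v)"
  using assms
proof (induction s arbitrary: v)
  case 0
  then show ?case
    using start by (simp add: at_start_def start_label_def r_def)
next
  case (Suc s)
  have none: "solution (run E \<omega> (t + s) u) = None" if "u \<in> V" for u
    using Suc that gs[OF that] by (cases "gs u") auto
  have "sent E \<omega> (t + s) u v = label R K L r s u" if "u \<in> neighbours R v" for u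
    using that Suc none neighbours_vertexD[OF clustering.graph[OF clustering_R] that]
    by (auto simp: machine_msg_def neighbours_def R_def)
  then have "(\<lambda>u. sent E \<omega> (t + s) u v - K) ` neighbours R v
      = (\<lambda>u. label R K L r s u - K) ` neighbours R v"
    by (intro image_cong) auto
  then show ?case
    using Suc none[OF Suc.prems(2)] HE
    by (simp add: run_Suc neighbours_R del: machine_run.simps)
qed

lemma run_inform:
  assumes v: "v \<in> V"
  shows "run E \<omega> (Suc (t + L)) v =
    Inform v (nbs v) (tl (gs v)) K L (sorted_list_of_set (neighbours H v))
      (sorted_list_of_set (picks K (neighbours R v) (label R K L r L)))"
proof -
  have none: "solution (run E \<omega> (t + L) u) = None" if "u \<in> V" for u
    using run_label[OF order_refl that] gs[OF that] by (cases "gs u") auto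
  have "sent E \<omega> (t + L) u v = label R K L r L u" if "u \<in> neighbours R v" for u
    using that none run_label neighbours_vertexD[OF clustering.graph[OF clustering_R] that]
    by (auto simp: machine_msg_def neighbours_def R_def)
  then have "picks K (neighbours R v) (\<lambda>u. sent E \<omega> (t + L) u v)
      = picks K (neighbours R v) (label R K L r L)"
    by (rule picks_cong)
  then show ?thesis
    using none[OF v] run_label[OF order_refl v] HE
    by (simp add: run_Suc neighbours_R del: machine_run.simps)
qed

text \<open>Every edge of the layer was picked at one of its ends. This is why one round of
  announcements lets both ends agree on the chosen edges.\<close>

lemma neighbours_layer:
  assumes "v \<in> V"
  shows "neighbours (layer V R K L r) v = picks K (neighbours R v) (label R K L r L)
    \<union> {u \<in> neighbours E v. v \<in> picks K (neighbours R u) (label R K L r L)}" (is "?l = ?r")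
proof (intro equalityI subsetI)
  fix u assume "u \<in> ?l"
  then obtain x p where xp: "x \<in> V" "p \<in> picks K (neighbours R x) (label R K L r L)" "{u, v} = {x, p}"
    by (auto simp: neighbours_def layer_def)
  have "{u, v} \<in> R"
    using \<open>u \<in> ?l\<close> clustering.layer_subset[OF clustering_R] by (auto simp: neighbours_def)
  then have "u \<in> neighbours E v" by (auto simp: neighbours_def R_def)
  then show "u \<in> ?r" using xp by (auto simp: doubleton_eq_iff)
next
  fix u assume "u \<in> ?r"
  then have "{v, u} \<in> layer V R K L r \<or> {u, v} \<in> layer V R K L r"
    using assms neighbours_vertexD[OF graph, of u v] unfolding layer_def by blast
  then show "u \<in> ?l"
    by (auto simp: neighbours_def insert_commute)
qed

text \<open>Of the \<open>L + 2\<close> rounds, \<open>L\<close> propagate labels, one exchanges the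
  final labels and makes the picks, and one announces them.\<close>

lemma run_next:
  "at_start \<omega> (t + (L + 2)) (\<lambda>v. tl (gs v)) K L (H \<union> layer V R K L r)"
  unfolding at_start_def
proof (intro conjI ballI)
  let ?P = "\<lambda>v. picks K (neighbours R v) (label R K L r L)"
  show sub: "H \<union> layer V R K L r \<subseteq> E"
    using HE clustering.layer_subset[OF clustering_R] by (auto simp: R_def)
  fix v assume v: "v \<in> V"
  have finP: "finite (?P u)" for u
    unfolding picks_def using clustering.fin[OF clustering_R] by auto
  have "sent E \<omega> (Suc (t + L)) u v = of_bool (v \<in> ?P u)" if "u \<in> neighbours E v" for u
    using that run_inform[of u] neighbours_vertexD[OF graph that] finP
    by (simp add: machine_msg_def neighbours_def del: machine_run.simps)
  then have "{u \<in> neighbours E v. sent E \<omega> (Suc (t + L)) u v = 1} = {u \<in> neighbours E v. v \<in> ?P u}"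
    by (intro Collect_cong conj_cong) (simp_all del: machine_run.simps One_nat_def)
  moreover have "neighbours (H \<union> layer V R K L r) v = neighbours H v \<union> neighbours (layer V R K L r) v"
    by (auto simp: neighbours_def)
  ultimately show "run E \<omega> (t + (L + 2)) v =
      Cluster v (nbs v) (tl (gs v)) K L
        (sorted_list_of_set (neighbours (H \<union> layer V R K L r) v)) 0 (start_label K L (tl (gs v)) v)"
    using run_Suc[of E \<omega> "Suc (t + L)" v] run_inform[OF v] finP HE
    by (simp add: neighbours_layer[OF v] Un_assoc del: machine_run.simps)
qed

lemma sent_le_cluster:
  assumes "t \<le> t'" "t' < t + (L + 2)"
  shows "sent E \<omega> t' u v \<le> (2 * L + 1) * K + 1"
proof (cases "{u, v} \<in> E")
  case True
  then have u: "u \<in> V" using simple_graph_edgeD[OF graph] by auto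
  show ?thesis
  proof (cases "t' = Suc (t + L)")
    case True
    then show ?thesis using run_inform[OF u] by (simp add: machine_msg_def del: machine_run.simps)
  next
    case False
    define s where "s = t' - t"
    have s: "t' = t + s" "s \<le> L" using assms False by (auto simp: s_def)
    show ?thesis
      using run_label[OF s(2) u] clustering.label_bound[OF clustering_R u s(2)]
      by (simp add: machine_msg_def s(1) del: machine_run.simps)
  qed
qed (simp add: machine_msg_def)

end

lemma run_layers:
  assumes "at_start \<omega> t gs K L H" "V \<subseteq> {..<K}" "\<And>v. v \<in> V \<Longrightarrow> length (gs v) = k"
  shows "(\<forall>v\<in>V. solution (run E \<omega> (t + k * (L + 2)) v) =
      Some (neighbours (H \<union> layers V K L k (E - H) gs) v)) \<and>
    (\<forall>t'\<ge>t. \<forall>u v. sent E \<omega> t' u v \<le> (2 * L + 1) * K + 1)"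
  using assms
proof (induction k arbitrary: t gs H)
  case 0
  have sol: "solution (run E \<omega> t v) = Some (neighbours H v)" if "v \<in> V" for v
    using 0 that by (auto simp: at_start_def)
  \<comment> \<open>Terminated vertices keep their states and fall silent, which settles all later
    messages.\<close>
  have stay: "run E \<omega> (t + i) v = run E \<omega> t v" if "v \<in> V" for i v
    using sol[OF that] by (induction i) (auto simp: run_Suc simp del: machine_run.simps)
  have "sent E \<omega> t' u v = 0" if "t' \<ge> t" for t' u v
    using that stay[of u "t' - t"] sol[of u] simple_graph_edgeD[OF graph, of u v]
    by (auto simp: machine_msg_def)
  then show ?case using sol by simp
next
  case (Suc k)
  have ne: "gs v \<noteq> []" if "v \<in> V" for v using Suc.prems(3)[OF that] by auto
  let ?H = "layer V (E - H) K L (\<lambda>v. min (hd (gs v)) L)"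
  have "at_start \<omega> (t + (L + 2)) (\<lambda>v. tl (gs v)) K L (H \<union> ?H)"
    using run_next[OF Suc.prems(1) ne Suc.prems(2)] .
  note IH = Suc.IH[OF this Suc.prems(2)]
  have len: "length (tl (gs v)) = k" if "v \<in> V" for v using Suc.prems(3)[OF that] by simp
  have "E - (H \<union> ?H) = E - H - ?H" by auto
  then have layers: "H \<union> ?H \<union> layers V K L k (E - (H \<union> ?H)) (\<lambda>v. tl (gs v)) = H \<union> layers V K L (Suc k) (E - H) gs"
    by (simp add: Let_def Un_assoc)
  have time: "t + (L + 2) + k * (L + 2) = t + Suc k * (L + 2)" by simp
  have fin: "\<forall>v\<in>V. solution (run E \<omega> (t + Suc k * (L + 2)) v) =
      Some (neighbours (H \<union> layers V K L (Suc k) (E - H) gs) v)"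
    using IH[OF len] unfolding layers time by blast
  have later: "\<forall>t'\<ge>t + (L + 2). \<forall>u v. sent E \<omega> t' u v \<le> (2 * L + 1) * K + 1"
    using IH[OF len] by blast
  have "sent E \<omega> t' u v \<le> (2 * L + 1) * K + 1" if "t' \<ge> t" for t' u v
  proof (cases "t' < t + (L + 2)")
    case True
    then show ?thesis using sent_le_cluster[OF Suc.prems(1) ne Suc.prems(2) that] by blast
  next
    case False
    then show ?thesis using later by (meson not_less)
  qed
  then show ?case using fin by blast
qed

end

section \<open>Running time and message sizes\<close>

context connected_graph
begin

definition finish where "finish = 3 * settle + 2 + 3 * (radius + 2)"

lemma id_less: "V \<subseteq> {..<Suc top_id}"
  using finV unfolding top_id_def by (auto simp: less_Suc_eq_le)

lemma run_finish:
  assumes "card V \<ge> 2" "\<And>v. v \<in> V \<Longrightarrow> length (\<omega> v) = 3"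
  shows "v \<in> V \<Longrightarrow> solution (run E \<omega> finish v) =
      Some (neighbours (layers V (Suc top_id) radius 3 E \<omega>) v)"
    and "t \<ge> 3 * settle + 2 \<Longrightarrow> sent E \<omega> t u v \<le> (2 * radius + 1) * Suc top_id + 1"
proof -
  have "at_start \<omega> (3 * settle + 2) \<omega> (Suc top_id) radius {}"
    using run_cluster_start[OF assms(1)] unfolding at_start_def by (simp add: neighbours_def)
  from run_layers[OF this id_less assms(2)]
  show "v \<in> V \<Longrightarrow> solution (run E \<omega> finish v) =
      Some (neighbours (layers V (Suc top_id) radius 3 E \<omega>) v)"
    "t \<ge> 3 * settle + 2 \<Longrightarrow> sent E \<omega> t u v \<le> (2 * radius + 1) * Suc top_id + 1"
    unfolding finish_def Un_empty_left Diff_empty by blast+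
qed

text \<open>A shortest walk is no longer than the number of adjacent pairs. This crude polynomial
  bound serves to bound message sizes.\<close>

lemma diameter_le: "graph_diameter V E \<le> card V ^ 2"
proof -
  have "graph_dist E u v \<le> card V ^ 2" if "u \<in> V" "v \<in> V" for u v
  proof -
    have sub: "adj_rel E \<subseteq> V \<times> V"
      using simple_graph_edgeD[OF graph] by (auto simp: adj_rel_def)
    then have fin: "finite (adj_rel E)" using finV finite_subset by blast
    have "(u, v) \<in> (adj_rel E)\<^sup>*" using that conn by (auto simp: graph_connected_def)
    then obtain k where k: "(u, v) \<in> adj_rel E ^^ k" "k \<le> card (adj_rel E)"
      using rtrancl_finite_eq_relpow[OF fin] by auto
    have "graph_dist E u v \<le> k" unfolding graph_dist_def using k(1) by (rule Least_le)
    also have "\<dots> \<le> card (V \<times> V)" using k(2) sub finV card_mono[OF _ sub] by simp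
    finally show ?thesis by (simp add: power2_eq_square card_cartesian_product)
  qed
  moreover have "{graph_dist E u v |u v. u \<in> V \<and> v \<in> V} = (\<lambda>(u, v). graph_dist E u v) ` (V \<times> V)"
    by auto
  ultimately show ?thesis
    unfolding graph_diameter_def using finV neV by (subst Max_le_iff) auto
qed

lemma max_degree_less: "max_degree < card V"
proof -
  have "card (neighbours E v) < card V" if "v \<in> V" for v
  proof (rule psubset_card_mono[OF finV])
    have "v \<notin> neighbours E v" using simple_graph_edgeD(3)[OF graph, of v v] by (auto simp: neighbours_def)
    then show "neighbours E v \<subset> V" using neighbours_subset[OF graph] that by blast
  qed
  then show ?thesis unfolding max_degree_def using finV neV by simp
qed

lemma flood_degree_le: "v \<in> V \<Longrightarrow> flood E (\<lambda>v. card (neighbours E v)) t v \<le> max_degree"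
  using flood_attained[OF graph, of t v "\<lambda>v. card (neighbours E v)"] nball_subset[OF graph, of v t] finV
  unfolding max_degree_def by (auto intro!: Max_ge)

lemma length_bits_degree: "2 ^ length (bits (Suc max_degree)) \<le> 2 * card V"
  using power_length_bits_le[of "Suc max_degree"] max_degree_less by simp

lemma radius_le: "2 \<le> card V \<Longrightarrow> radius \<le> card V ^ 4"
proof -
  assume n: "2 \<le> card V"
  have "length (bits (Suc max_degree)) < 2 ^ length (bits (Suc max_degree))" by (rule less_exp)
  also have "\<dots> \<le> 2 * card V" by (rule length_bits_degree)
  also have "\<dots> \<le> card V ^ 2" using n by (simp add: power2_eq_square)
  finally have "length (bits (Suc max_degree)) \<le> card V ^ 2" by simp
  moreover have "settle \<le> card V ^ 2" using settle_le_diameter diameter_le by (rule order_trans)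
  ultimately have "radius \<le> card V ^ 2 * card V ^ 2" unfolding radius_def by (rule mult_le_mono[rotated])
  then show ?thesis by (simp flip: power_add)
qed

end

text \<open>The pairing function is at most quadratic, and \<open>4 \<le> n ^ 2\<close> absorbs the
  constant, so pairing preserves polynomial bounds.\<close>

lemma prod_encode_le_power:
  assumes "a \<le> n ^ k" "b \<le> n ^ k" "2 \<le> n"
  shows "prod_encode (a, b) \<le> n ^ (2 * k + 4)"
proof -
  have "prod_encode (a, b) \<le> (a + b + 1) ^ 2"
    unfolding prod_encode_def triangle_def by (simp add: power2_eq_square)
  also have "\<dots> \<le> (n ^ (k + 2)) ^ 2"
  proof (rule power_mono)
    have "1 \<le> n ^ k" using assms by (intro one_le_power) simp
    then have "a + b + 1 \<le> 4 * n ^ k" using assms by linarith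
    also have "\<dots> \<le> n ^ 2 * n ^ k" using power_mono[of 2 n 2] assms by (intro mult_right_mono) auto
    finally show "a + b + 1 \<le> n ^ (k + 2)" by (simp only: power_add mult.commute)
  qed simp
  also have "\<dots> = n ^ (2 * k + 4)"
  proof -
    have "(k + 2) * 2 = 2 * k + 4" by simp
    then show ?thesis by (simp only: power_mult[symmetric])
  qed
  finally show ?thesis .
qed

context connected_graph
begin

text \<open>The exponent comes from the exploration: degree and time are at most
  \<open>card V ^ 2\<close> and pair to \<open>card V ^ 8\<close>; pairing with the id, both
  weakened to exponent \<open>c + 8\<close>, gives \<open>2 * (c + 8) + 4\<close>. Later messages
  stay within exponent \<open>c + 6\<close>.\<close>

lemma sent_le:
  assumes n: "card V \<ge> 2" and \<omega>: "\<And>v. v \<in> V \<Longrightarrow> length (\<omega> v) = 3"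
    and ids: "V \<subseteq> {..<card V ^ c}"
  shows "sent E \<omega> t u v \<le> card V ^ (2 * c + 20)"
proof (cases "{u, v} \<in> E")
  case True
  then have u: "u \<in> V" using simple_graph_edgeD[OF graph] by auto
  let ?n = "card V"
  have top: "Suc top_id \<le> ?n ^ c" using ids top_id_in by auto
  show ?thesis
  proof (cases "t < 3 * settle + 2")
    case True
    have "flood E (\<lambda>v. card (neighbours E v)) t u \<le> ?n ^ 2"
      using flood_degree_le[OF u, of t] max_degree_less self_le_power[of ?n 2] n by linarith
    moreover have "last_change E t u \<le> ?n ^ 2"
      using last_change_le_settle[OF u, of t] settle_le_diameter diameter_le by linarith
    ultimately have "prod_encode (flood E (\<lambda>v. card (neighbours E v)) t u, last_change E t u)
        \<le> ?n ^ (2 * 2 + 4)"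
      using n by (rule prod_encode_le_power)
    also have "\<dots> \<le> ?n ^ (c + 8)" using n by (intro power_increasing) auto
    finally have 1: "prod_encode (flood E (\<lambda>v. card (neighbours E v)) t u, last_change E t u)
        \<le> ?n ^ (c + 8)" .
    have "max_id E t u \<le> ?n ^ c" using max_id_le[OF u, of t] top by simp
    also have "\<dots> \<le> ?n ^ (c + 8)" using n by (intro power_increasing) auto
    finally have "prod_encode (max_id E t u,
        prod_encode (flood E (\<lambda>v. card (neighbours E v)) t u, last_change E t u))
        \<le> ?n ^ (2 * (c + 8) + 4)"
      using 1 n by (rule prod_encode_le_power)
    moreover have "sent E \<omega> t u v = prod_encode (max_id E t u,
        prod_encode (flood E (\<lambda>v. card (neighbours E v)) t u, last_change E t u))"
      using run_explore[OF n True u] \<open>{u, v} \<in> E\<close> by (simp add: machine_msg_def)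
    moreover have "2 * (c + 8) + 4 = 2 * c + 20" by simp
    ultimately show ?thesis by (simp only:)
  next
    case False
    have "sent E \<omega> t u v \<le> (2 * radius + 1) * Suc top_id + 1"
      using run_finish(2)[OF n \<omega>] False by simp
    also have "\<dots> \<le> (2 * ?n ^ 4 + 1) * ?n ^ c + 1"
      using radius_le[OF n] top by (intro add_right_mono mult_le_mono) auto
    also have "\<dots> \<le> 2 ^ 2 * ?n ^ 4 * ?n ^ c"
    proof -
      have "1 \<le> ?n ^ 4" "1 \<le> ?n ^ c" using n by (auto intro: one_le_power)
      then have "1 \<le> ?n ^ 4 * ?n ^ c" "1 * ?n ^ c \<le> ?n ^ 4 * ?n ^ c" by (auto intro: mult_right_mono)
      moreover have "(2 * ?n ^ 4 + 1) * ?n ^ c + 1 = 2 * (?n ^ 4 * ?n ^ c) + ?n ^ c + 1"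
        "2 ^ 2 * ?n ^ 4 * ?n ^ c = 4 * (?n ^ 4 * ?n ^ c)"
        by (simp_all add: algebra_simps)
      ultimately show ?thesis by linarith
    qed
    also have "\<dots> \<le> ?n ^ 2 * ?n ^ 4 * ?n ^ c" using n by (intro mult_right_mono power_mono) auto
    also have "\<dots> = ?n ^ (6 + c)" by (simp flip: power_add)
    also have "\<dots> \<le> ?n ^ (2 * c + 20)" using n by (intro power_increasing) auto
    finally show ?thesis .
  qed
qed (simp add: machine_msg_def)

lemma diameter_pos:
  assumes "card V \<ge> 2"
  shows "1 \<le> graph_diameter V E"
proof (rule ccontr)
  assume "\<not> 1 \<le> graph_diameter V E"
  then have "V = {top_id}" using nball_diameter[OF top_id_in] by (simp add: not_le)
  then have "card V = 1" by (metis card.empty card_insert_disjoint finite.emptyI empty_iff One_nat_def)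
  then show False using assms by simp
qed

lemma finish_le:
  assumes n: "card V \<ge> 2"
  shows "real finish \<le> 20 * real (graph_diameter V E) * log 2 (real (card V)) ^ 3"
proof -
  let ?D = "real (graph_diameter V E)" and ?l = "log 2 (real (card V))"
  have D: "1 \<le> ?D" using diameter_pos[OF n] by simp
  have l: "1 \<le> ?l" using n by simp
  have "real (length (bits (Suc max_degree))) \<le> 1 + log 2 (real (Suc max_degree))"
    by (rule length_bits_le_log) simp
  also have "log 2 (real (Suc max_degree)) \<le> ?l"
    using max_degree_less by (intro log_mono) auto
  finally have "real (length (bits (Suc max_degree))) \<le> 2 * ?l" using l by simp
  then have "real radius \<le> ?D * (2 * ?l)"
    unfolding radius_def of_nat_mult using settle_le_diameter by (intro mult_mono) auto
  moreover have "real settle \<le> ?D" using settle_le_diameter by simp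
  ultimately have "real finish \<le> 3 * ?D + 8 + 6 * (?D * ?l)"
    unfolding finish_def by simp
  moreover have "?D * 1 \<le> ?D * ?l" using D l by (intro mult_left_mono) auto
  ultimately have "real finish \<le> 20 * ?D * ?l" using D by linarith
  \<comment> \<open>The bound so far is linear in \<open>?l\<close>; the cube enters through
    \<open>?l \<ge> 1\<close>.\<close>
  also have "\<dots> \<le> 20 * ?D * ?l ^ 3"
    using D l self_le_power[of ?l 3] by (intro mult_left_mono) auto
  finally show ?thesis .
qed

end

section \<open>Correctness and approximation ratio of the algorithm\<close>

definition ecss_alg :: "nat congest_alg" where
  "ecss_alg = machine_alg (replicate_pmf 3 geo) init_state out_msg next_state solution"

lemma result_ecss_alg: "v \<in> V \<Longrightarrow> result ecss_alg (encode_states V \<sigma> v) = solution (\<sigma> v)"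
  by (simp add: ecss_alg_def machine_alg_def encode_states_def)

lemma chosen_edges_encode:
  assumes "simple_graph V E" "H \<subseteq> E" "\<And>v. v \<in> V \<Longrightarrow> solution (\<sigma> v) = Some (neighbours H v)"
  shows "chosen_edges ecss_alg E (encode_states V \<sigma>) = H"
    and "all_done ecss_alg V E (encode_states V \<sigma>)"
proof -
  show chosen: "chosen_edges ecss_alg E (encode_states V \<sigma>) = H"
  proof (intro equalityI subsetI)
    fix e assume "e \<in> chosen_edges ecss_alg E (encode_states V \<sigma>)"
    then obtain u v S where "e = {u, v}" "{u, v} \<in> E"
      "result ecss_alg (encode_states V \<sigma> u) = Some S" "v \<in> S"
      unfolding chosen_edges_def by auto
    moreover have "u \<in> V" using calculation simple_graph_edgeD[OF assms(1)] by auto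
    ultimately show "e \<in> H"
      using assms(3) by (auto simp: result_ecss_alg neighbours_def insert_commute)
  next
    fix e assume e: "e \<in> H"
    then have "card e = 2" using assms unfolding simple_graph_def by auto
    then obtain u v where uv: "e = {u, v}" by (meson card_2_iff)
    then have "u \<in> V" using simple_graph_edgeD[OF assms(1), of u v] e assms(2) by auto
    then have "result ecss_alg (encode_states V \<sigma> u) = Some (neighbours H u)"
      using assms(3) by (simp add: result_ecss_alg)
    moreover have "v \<in> neighbours H u" using e uv by (simp add: neighbours_def insert_commute)
    ultimately show "e \<in> chosen_edges ecss_alg E (encode_states V \<sigma>)"
      unfolding chosen_edges_def using e uv assms(2) by blast
  qed
  show "all_done ecss_alg V E (encode_states V \<sigma>)"
    unfolding all_done_def chosen using assms(3) by (simp add: result_ecss_alg)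
qed

text \<open>Connectivity puts every vertex on some edge of \<open>H\<close>, and an edge covers two
  vertices.\<close>

lemma card_le_edges:
  assumes "simple_graph V E" "card V \<ge> 2" "ecss 3 V E H"
  shows "card V \<le> 2 * card H"
proof -
  have HE: "H \<subseteq> E" using assms by (simp add: ecss_def)
  have fin: "finite H" using finite_edges[OF assms(1)] HE finite_subset by blast
  have "graph_connected V (H - {})"
    using assms(3) unfolding ecss_def edge_connected_def by (metis card.empty empty_subsetI zero_less_numeral)
  then have conn: "graph_connected V H" by simp
  have "V \<subseteq> \<Union> H"
  proof
    fix v assume v: "v \<in> V"
    have "V \<noteq> {v}" using assms(2) by auto
    then obtain w where "w \<in> V" "w \<noteq> v" using v by blast
    then have "(v, w) \<in> (adj_rel H)\<^sup>+" using conn v unfolding graph_connected_def by (metis rtranclD)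
    then obtain u where "(v, u) \<in> adj_rel H" by (meson tranclD)
    then show "v \<in> \<Union> H" by (auto simp: adj_rel_def)
  qed
  moreover have "finite (\<Union> H)"
    using HE assms(1) unfolding simple_graph_def by (intro finite_subset[of "\<Union> H" V]) auto
  ultimately have "card V \<le> card (\<Union> H)" by (intro card_mono)
  also have "\<dots> \<le> (\<Sum>e\<in>H. card e)" by (rule card_Union_le_sum_card)
  also have "\<dots> = (\<Sum>e\<in>H. 2)"
    using HE assms(1) unfolding simple_graph_def by (intro sum.cong) auto
  finally show ?thesis by simp
qed

lemma card_le_min_ecss:
  assumes "simple_graph V E" "card V \<ge> 2" "edge_connected 3 V E"
  shows "card V \<le> 2 * min_ecss_size 3 V E"
proof -
  have "finite {H. ecss 3 V E H}"
    using finite_edges[OF assms(1)] by (rule finite_subset[rotated, OF finite_Pow_iff[THEN iffD2]]) (auto simp: ecss_def)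
  moreover have "E \<in> {H. ecss 3 V E H}" using assms(3) by (simp add: ecss_def)
  ultimately have "min_ecss_size 3 V E \<in> card ` {H. ecss 3 V E H}"
    unfolding min_ecss_size_def by (intro Min_in) auto
  then show ?thesis using card_le_edges[OF assms(1,2)] by auto
qed

lemma edge_connected_connected: "edge_connected k V E \<Longrightarrow> 0 < k \<Longrightarrow> graph_connected V E"
  unfolding edge_connected_def by (metis Diff_empty card.empty empty_subsetI)

lemma ecss_alg_correct_large:
  assumes E: "simple_graph V E" "V \<subseteq> {..<card V ^ c}" "edge_connected 3 V E" and n: "card V \<ge> 2"
  shows "message_bits_le ecss_alg V E (real (2 * c + 21) * log 2 (real (card V)))"
    and "\<exists>T. real T \<le> 20 * real (graph_diameter V E) * log 2 (real (card V)) ^ 3 \<and>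
      (\<forall>\<sigma>\<in>set_pmf (congest_run ecss_alg V E T).
        all_done ecss_alg V E \<sigma> \<and> ecss 3 V E (chosen_edges ecss_alg E \<sigma>)) \<and>
      measure_pmf.expectation (congest_run ecss_alg V E T)
        (\<lambda>\<sigma>. real (card (chosen_edges ecss_alg E \<sigma>)))
      \<le> 72 * log 2 (real (card V)) * real (min_ecss_size 3 V E)"
proof -
  interpret connected_graph V E
    using E(1) edge_connected_connected[OF E(3)] by unfold_locales auto
  let ?P = "Pi_pmf V [] (\<lambda>_. replicate_pmf 3 geo)"
  let ?H = "layers V (Suc top_id) radius 3 E"
  have run: "congest_run ecss_alg V E t = map_pmf (\<lambda>\<omega>. encode_states V (run E \<omega> t)) ?P" for t
    unfolding ecss_alg_def by (rule congest_run_machine_alg[OF E(1)])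
  have len: "length (\<omega> v) = 3" if "\<omega> \<in> set_pmf ?P" "v \<in> V" for \<omega> v
    using that by (auto simp: set_Pi_pmf[OF finV] PiE_dflt_def set_replicate_pmf simp del: replicate_pmf.simps)
  have HE: "?H \<omega> \<subseteq> E" for \<omega> by (rule layers_subset[OF E(1) id_less])
  show "message_bits_le ecss_alg V E (real (2 * c + 21) * log 2 (real (card V)))"
    unfolding message_bits_le_def
  proof (intro allI ballI)
    fix t \<sigma> u v assume "\<sigma> \<in> set_pmf (congest_run ecss_alg V E t)"
    then obtain \<omega> where \<omega>: "\<omega> \<in> set_pmf ?P" "\<sigma> = encode_states V (run E \<omega> t)"
      unfolding run by auto
    have "real (length (bits (sent E \<omega> t u v))) \<le> (1 + real (2 * c + 20)) * log 2 (real (card V))"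
      using sent_le[OF n len[OF \<omega>(1)] E(2)] n by (rule length_bits_le_if_le_power)
    then show "real (length (message ecss_alg E \<sigma> u v)) \<le> real (2 * c + 21) * log 2 (real (card V))"
      unfolding \<omega>(2) ecss_alg_def message_machine_alg[OF E(1)] by (simp add: algebra_simps)
  qed
  have finished: "chosen_edges ecss_alg E (encode_states V (run E \<omega> finish)) = ?H \<omega>"
    "all_done ecss_alg V E (encode_states V (run E \<omega> finish))" if "\<omega> \<in> set_pmf ?P" for \<omega>
    using chosen_edges_encode[OF E(1) HE run_finish(1)[OF n len[OF that]]] by auto
  have ecss: "ecss 3 V E (?H \<omega>)" for \<omega>
    unfolding ecss_def using HE layers_edge_connected[OF E(1) id_less E(3)] by simp
  have "measure_pmf.expectation (congest_run ecss_alg V E finish)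
      (\<lambda>\<sigma>. real (card (chosen_edges ecss_alg E \<sigma>)))
    = measure_pmf.expectation ?P (\<lambda>\<omega>. real (card (?H \<omega>)))"
    unfolding run integral_map_pmf
    using finished by (intro integral_cong_AE) (auto simp: AE_measure_pmf_iff simp del: layers.simps)
  also have "\<dots> = enn2real (\<integral>\<^sup>+\<omega>. of_nat (card (?H \<omega>)) \<partial>?P)"
    by (subst integral_eq_nn_integral) (auto simp: ennreal_of_nat_eq_real_of_nat)
  also have "\<dots> \<le> real (12 * card V * 3)"
    using expected_layers_le[OF E(1) id_less card_le_radius, of 3]
    by (intro enn2real_leI) (auto simp only: ennreal_of_nat_eq_real_of_nat of_nat_0_le_iff)
  \<comment> \<open>Three layers with at most 12 expected edges per vertex each give 36; the optimum
    has at least half as many edges as there are vertices, which doubles this to 72.\<close>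
  also have "\<dots> \<le> 72 * 1 * real (min_ecss_size 3 V E)"
    using card_le_min_ecss[OF E(1) n E(3)] by simp
  also have "\<dots> \<le> 72 * log 2 (real (card V)) * real (min_ecss_size 3 V E)"
    using n by (intro mult_right_mono mult_left_mono) auto
  finally show "\<exists>T. real T \<le> 20 * real (graph_diameter V E) * log 2 (real (card V)) ^ 3 \<and>
      (\<forall>\<sigma>\<in>set_pmf (congest_run ecss_alg V E T).
        all_done ecss_alg V E \<sigma> \<and> ecss 3 V E (chosen_edges ecss_alg E \<sigma>)) \<and>
      measure_pmf.expectation (congest_run ecss_alg V E T)
        (\<lambda>\<sigma>. real (card (chosen_edges ecss_alg E \<sigma>)))
      \<le> 72 * log 2 (real (card V)) * real (min_ecss_size 3 V E)"
    using finish_le[OF n] finished ecss by (intro exI[of _ finish]) (auto simp: run)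
qed

text \<open>Since \<open>log 2 1 = 0\<close>, the bounds allow no message bits, no rounds and no
  chosen edges. A single vertex meets them: there are no edges, and its initial state is already
  final.\<close>

lemma ecss_alg_correct_single:
  assumes E: "simple_graph V E" "edge_connected 3 V E" and n: "card V < 2"
  shows "message_bits_le ecss_alg V E (b * log 2 (real (card V)))"
    and "\<forall>\<sigma>\<in>set_pmf (congest_run ecss_alg V E 0).
      all_done ecss_alg V E \<sigma> \<and> ecss 3 V E (chosen_edges ecss_alg E \<sigma>)"
    and "measure_pmf.expectation (congest_run ecss_alg V E 0)
      (\<lambda>\<sigma>. real (card (chosen_edges ecss_alg E \<sigma>))) = 0"
    and "card V = 1"
proof -
  have "finite V" "V \<noteq> {}" using E by (auto simp: simple_graph_def)
  then have "card V \<noteq> 0" by simp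
  then show card: "card V = 1" using n by simp
  have E_empty: "E = {}"
  proof (rule ccontr)
    assume "E \<noteq> {}"
    then obtain e where "e \<subseteq> V" "card e = 2" using E(1) unfolding simple_graph_def by auto
    then show False using card_mono[OF \<open>finite V\<close>, of e] card by simp
  qed
  show "message_bits_le ecss_alg V E (b * log 2 (real (card V)))"
    by (simp add: message_bits_le_def message_def E_empty card)
  show "measure_pmf.expectation (congest_run ecss_alg V E 0)
      (\<lambda>\<sigma>. real (card (chosen_edges ecss_alg E \<sigma>))) = 0"
    by (simp add: chosen_edges_def E_empty)
  have run: "congest_run ecss_alg V E 0 = map_pmf (\<lambda>\<omega>. encode_states V (run E \<omega> 0))
      (Pi_pmf V [] (\<lambda>_. replicate_pmf 3 geo))"
    unfolding ecss_alg_def by (rule congest_run_machine_alg[OF E(1)])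
  show "\<forall>\<sigma>\<in>set_pmf (congest_run ecss_alg V E 0).
      all_done ecss_alg V E \<sigma> \<and> ecss 3 V E (chosen_edges ecss_alg E \<sigma>)"
  proof
    fix \<sigma> assume "\<sigma> \<in> set_pmf (congest_run ecss_alg V E 0)"
    then obtain \<omega> where \<sigma>: "\<sigma> = encode_states V (run E \<omega> 0)" unfolding run by auto
    have "solution (run E \<omega> 0 v) = Some (neighbours {} v)" for v
      by (simp add: init_state_def neighbours_def E_empty)
    from chosen_edges_encode[OF E(1) empty_subsetI this]
    show "all_done ecss_alg V E \<sigma> \<and> ecss 3 V E (chosen_edges ecss_alg E \<sigma>)"
      using E(2) unfolding \<sigma> by (simp add: ecss_def E_empty)
  qed
qed

theorem theorem3:
  shows "\<exists>(A :: nat congest_alg) (C_apx :: real) (C_time :: real).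
    \<forall>c :: nat. \<exists>C_msg :: real.
    \<forall>(V :: nat set) (E :: nat set set).
      simple_graph V E \<and> V \<subseteq> {..<card V ^ c} \<and> edge_connected 3 V E \<longrightarrow>
        message_bits_le A V E (C_msg * log 2 (real (card V))) \<and>
        (\<exists>T :: nat.
           real T \<le> C_time * real (graph_diameter V E) * log 2 (real (card V)) ^ 3 \<and>
           (\<forall>\<sigma>\<in>set_pmf (congest_run A V E T).
              all_done A V E \<sigma> \<and> ecss 3 V E (chosen_edges A E \<sigma>)) \<and>
           measure_pmf.expectation (congest_run A V E T)
               (\<lambda>\<sigma>. real (card (chosen_edges A E \<sigma>)))
             \<le> C_apx * log 2 (real (card V)) * real (min_ecss_size 3 V E))"
proof (rule exI[of _ ecss_alg], rule exI[of _ 72], rule exI[of _ 20], rule allI)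
  fix c :: nat
  show "\<exists>C_msg :: real.
    \<forall>(V :: nat set) (E :: nat set set).
      simple_graph V E \<and> V \<subseteq> {..<card V ^ c} \<and> edge_connected 3 V E \<longrightarrow>
        message_bits_le ecss_alg V E (C_msg * log 2 (real (card V))) \<and>
        (\<exists>T :: nat.
           real T \<le> 20 * real (graph_diameter V E) * log 2 (real (card V)) ^ 3 \<and>
           (\<forall>\<sigma>\<in>set_pmf (congest_run ecss_alg V E T).
              all_done ecss_alg V E \<sigma> \<and> ecss 3 V E (chosen_edges ecss_alg E \<sigma>)) \<and>
           measure_pmf.expectation (congest_run ecss_alg V E T)
               (\<lambda>\<sigma>. real (card (chosen_edges ecss_alg E \<sigma>)))
             \<le> 72 * log 2 (real (card V)) * real (min_ecss_size 3 V E))"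
  proof (rule exI[of _ "real (2 * c + 21)"], intro allI impI, elim conjE)
    fix V :: "nat set" and E :: "nat set set"
    assume E: "simple_graph V E" "V \<subseteq> {..<card V ^ c}" "edge_connected 3 V E"
    show "message_bits_le ecss_alg V E (real (2 * c + 21) * log 2 (real (card V))) \<and>
        (\<exists>T :: nat.
           real T \<le> 20 * real (graph_diameter V E) * log 2 (real (card V)) ^ 3 \<and>
           (\<forall>\<sigma>\<in>set_pmf (congest_run ecss_alg V E T).
              all_done ecss_alg V E \<sigma> \<and> ecss 3 V E (chosen_edges ecss_alg E \<sigma>)) \<and>
           measure_pmf.expectation (congest_run ecss_alg V E T)
               (\<lambda>\<sigma>. real (card (chosen_edges ecss_alg E \<sigma>)))
             \<le> 72 * log 2 (real (card V)) * real (min_ecss_size 3 V E))"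
    proof (cases "card V < 2")
      case True
      note single = ecss_alg_correct_single[OF E(1,3) True]
      show ?thesis
        using single(1) single(2,3,4) by (intro conjI exI[of _ 0]) auto
    next
      case False
      then have "2 \<le> card V" by simp
      from ecss_alg_correct_large[OF E this] show ?thesis by auto
    qed
  qed
qed

end
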